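(* The linear projection of $\hat{G}_2\subset\mathbb{P}^{13}$ from (the linear span $\mathbb{P}^7$ of) $F$ is a birational map onto $\mathbb{P}^5$, whose inverse is the map $\varphi:\mathbb{P}^5\dashrightarrow\mathbb{P}^{13}$ defined by the system of all quadrics in $\mathbb{P}^5$ containing a common twisted cubic.
   Context: We work over $\mathbb{C}$. Let $V$ be a 7-dimensional vector space with basis $x_1,\dots,x_7$ and $\omega_0= x_1\wedge x_2 \wedge x_3 \wedge x_7+x_4\wedge x_5 \wedge x_6 \wedge x_7 + x_2\wedge x_3 \wedge x_5 \wedge x_6 + x_1\wedge x_3 \wedge x_4 \wedge x_6\in\bigwedge^4V$. Let $\hat{G}_2=\{[v_1\wedge v_2]\in G(2,V) : v_1\wedge v_2\wedge\omega_0=0\in\bigwedge^6V\}$, considered in its linear span $\mathbb{P}^{13}\subset\mathbb{P}(\bigwedge^2V)$. Let $F\subset\hat{G}_2$ be the Fano fourfold obtained as the intersection of $\hat{G}_2$ with $G(2,\langle x_2,x_3,x_4,x_6,x_7\rangle)$; it is a linear section of this Grassmannian $G(2,5)$ and spans a $\mathbb{P}^7\subset\mathbb{P}^{13}$. A twisted cubic in $\mathbb{P}^5$ is a rational normal curve of degree 3 spanning a $\mathbb{P}^3\subset\mathbb{P}^5$. *)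

theory Defs
  imports "HOL-Analysis.Analysis"
begin

section \<open>Complex projective space and its Zariski topology\<close>

text \<open>
  The points of \<open>P(W)\<close>, for a linear subspace \<open>W\<close> of \<open>complex ^ 'n\<close>, are the lines through the
  origin contained in \<open>W\<close>.
\<close>

definition proj_space :: "(complex ^ 'n) set \<Rightarrow> (complex ^ 'n) set set" where
  "proj_space W = {vec.span {w} | w. w \<in> W \<and> w \<noteq> 0}"

abbreviation PP :: "(complex ^ 'n) set set" where
  "PP \<equiv> proj_space UNIV"

definition lin_span :: "(complex ^ 'n) set set \<Rightarrow> (complex ^ 'n) set" where
  "lin_span X = vec.span (\<Union>X)"

text \<open>
  Homogeneous polynomials of degree \<open>d\<close>, regarded as functions; since the field of complex numbers
  is infinite, a polynomial is determined by its function.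
\<close>

definition form :: "nat \<Rightarrow> (complex ^ 'n \<Rightarrow> complex) \<Rightarrow> bool" where
  "form d f \<longleftrightarrow>
    (\<exists>c. \<forall>x. f x = (\<Sum>m | (\<Sum>i\<in>UNIV. m i) = d. c m * (\<Prod>i\<in>UNIV. (x $ i) ^ m i)))"

definition proj_zeros :: "(complex ^ 'n \<Rightarrow> complex) set \<Rightarrow> (complex ^ 'n) set set" where
  "proj_zeros S = {P \<in> PP. \<forall>f\<in>S. \<forall>v\<in>P. f v = 0}"

definition zariski_closed :: "(complex ^ 'n) set set \<Rightarrow> bool" where
  "zariski_closed Z \<longleftrightarrow> (\<exists>S. (\<forall>f\<in>S. \<exists>d. form d f) \<and> Z = proj_zeros S)"

definition zariski :: "(complex ^ 'n) set topology" where
  "zariski = topology (\<lambda>U. U \<subseteq> PP \<and> zariski_closed (PP - U))"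

lemma finite_exponents: "finite {m :: 'n::finite \<Rightarrow> nat. (\<Sum>i\<in>UNIV. m i) = d}"
proof (rule finite_subset)
  show "{m :: 'n \<Rightarrow> nat. (\<Sum>i\<in>UNIV. m i) = d} \<subseteq> {m. \<forall>i. (i \<in> UNIV \<longrightarrow> m i \<in> {..d}) \<and> (i \<notin> UNIV \<longrightarrow> m i = 0)}"
    by (auto intro: member_le_sum)
  show "finite {m :: 'n \<Rightarrow> nat. \<forall>i. (i \<in> UNIV \<longrightarrow> m i \<in> {..d}) \<and> (i \<notin> UNIV \<longrightarrow> m i = 0)}"
    by (rule finite_set_of_finite_funs) auto
qed

lemma form_scale:
  assumes "form d f"
  shows "f (k *s v) = k ^ d * f v"
proof -
  obtain c where c: "\<And>x. f x = (\<Sum>m | (\<Sum>i\<in>UNIV. m i) = d. c m * (\<Prod>i\<in>UNIV. (x $ i) ^ m i))"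
    using assms unfolding form_def by blast
  have "(\<Prod>i\<in>UNIV. ((k *s v) $ i) ^ m i) = k ^ (\<Sum>i\<in>UNIV. m i) * (\<Prod>i\<in>UNIV. (v $ i) ^ m i)" for m
    by (simp add: power_mult_distrib prod.distrib power_sum)
  then show ?thesis
    unfolding c sum_distrib_left by (intro sum.cong) auto
qed

lemma form_mult:
  fixes f g :: "complex ^ 'n \<Rightarrow> complex"
  assumes "form d f" "form e g"
  shows "form (d + e) (\<lambda>x. f x * g x)"
proof -
  let ?E = "\<lambda>d. {m :: 'n \<Rightarrow> nat. (\<Sum>i\<in>UNIV. m i) = d}"
  let ?M = "\<lambda>m (x :: complex ^ 'n). \<Prod>i\<in>UNIV. (x $ i) ^ m i"
  obtain a where a: "\<And>x. f x = (\<Sum>m\<in>?E d. a m * ?M m x)"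
    using assms(1) unfolding form_def by blast
  obtain b where b: "\<And>x. g x = (\<Sum>m\<in>?E e. b m * ?M m x)"
    using assms(2) unfolding form_def by blast
  let ?p = "\<lambda>z :: ('n \<Rightarrow> nat) \<times> ('n \<Rightarrow> nat). (\<lambda>i. fst z i + snd z i)"
  let ?c = "\<lambda>k. \<Sum>z | z \<in> ?E d \<times> ?E e \<and> ?p z = k. a (fst z) * b (snd z)"
  have "f x * g x = (\<Sum>k\<in>?E (d + e). ?c k * ?M k x)" for x
  proof -
    have "f x * g x = (\<Sum>z\<in>?E d \<times> ?E e. a (fst z) * b (snd z) * ?M (?p z) x)"
      unfolding a b sum_product sum.cartesian_product
      by (intro sum.cong) (auto simp: power_add prod.distrib)
    also have "\<dots> = (\<Sum>k\<in>?E (d + e). \<Sum>z | z \<in> ?E d \<times> ?E e \<and> ?p z = k. a (fst z) * b (snd z) * ?M (?p z) x)"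
      by (rule sum.group[symmetric]) (auto simp: finite_exponents sum.distrib)
    also have "\<dots> = (\<Sum>k\<in>?E (d + e). ?c k * ?M k x)"
      unfolding sum_distrib_right by (intro sum.cong) auto
    finally show ?thesis .
  qed
  then show ?thesis
    unfolding form_def by (intro exI[of _ ?c]) blast
qed

lemma zariski_closed_Un:
  fixes A B :: "(complex ^ 'n) set set"
  assumes "zariski_closed A" "zariski_closed B"
  shows "zariski_closed (A \<union> B)"
proof -
  obtain S where S: "\<forall>f\<in>S. \<exists>d. form d f" "A = proj_zeros S"
    using assms(1) unfolding zariski_closed_def by blast
  obtain T where T: "\<forall>f\<in>T. \<exists>d. form d f" "B = proj_zeros T"
    using assms(2) unfolding zariski_closed_def by blast
  define R where "R = (\<lambda>(f, g). \<lambda>x :: complex ^ 'n. f x * g x :: complex) ` (S \<times> T)"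
  have line: "(\<forall>u\<in>vec.span {v}. f u = 0) \<longleftrightarrow> f v = 0" if "\<exists>d. form d f" for f :: "complex ^ 'n \<Rightarrow> complex" and v
    using that by (auto simp: vec.span_singleton form_scale intro: vec.span_base)
  have forms: "\<exists>d. form d h" if "h \<in> R" for h
  proof -
    obtain f g where "f \<in> S" "g \<in> T" "h = (\<lambda>x. f x * g x)"
      using \<open>h \<in> R\<close> unfolding R_def by auto
    then show ?thesis using S(1) T(1) form_mult by metis
  qed
  have zeros: "vec.span {v} \<in> proj_zeros Q \<longleftrightarrow> (\<forall>f\<in>Q. f v = 0)"
    if "vec.span {v} \<in> PP" "\<And>f. f \<in> Q \<Longrightarrow> \<exists>d. form d f" for v :: "complex ^ 'n" and Q
    using that(1) line[OF that(2)] unfolding proj_zeros_def by simp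
  have "P \<in> A \<union> B \<longleftrightarrow> P \<in> proj_zeros R" for P
  proof (cases "P \<in> PP")
    case True
    then obtain v where v: "P = vec.span {v}" unfolding proj_space_def by blast
    have "P \<in> A \<longleftrightarrow> (\<forall>f\<in>S. f v = 0)" "P \<in> B \<longleftrightarrow> (\<forall>g\<in>T. g v = 0)"
      using True zeros[of v S] zeros[of v T] S T unfolding v by simp_all
    moreover have "P \<in> proj_zeros R \<longleftrightarrow> (\<forall>h\<in>R. h v = 0)"
      using True zeros[of v R] forms unfolding v by simp
    moreover have "(\<forall>h\<in>R. h v = 0) \<longleftrightarrow> (\<forall>f\<in>S. \<forall>g\<in>T. f v * g v = 0)"
      unfolding R_def by simp
    ultimately show ?thesis by auto
  next
    case False
    then show ?thesis using S T unfolding proj_zeros_def by simp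
  qed
  then have "A \<union> B = proj_zeros R" by (rule set_eqI)
  then show ?thesis
    using forms unfolding zariski_closed_def by (intro exI[of _ R]) simp
qed

lemma zariski_closed_Inter:
  assumes "\<And>Z. Z \<in> K \<Longrightarrow> zariski_closed Z"
  shows "zariski_closed (PP \<inter> \<Inter>K)"
proof -
  obtain S where S: "\<And>Z. Z \<in> K \<Longrightarrow> (\<forall>f\<in>S Z. \<exists>d. form d f) \<and> Z = proj_zeros (S Z)"
    using assms unfolding zariski_closed_def by metis
  have "P \<in> PP \<inter> \<Inter>K \<longleftrightarrow> P \<in> proj_zeros (\<Union>Z\<in>K. S Z)" for P
  proof -
    have "P \<in> PP \<inter> \<Inter>K \<longleftrightarrow> P \<in> PP \<and> (\<forall>Z\<in>K. P \<in> proj_zeros (S Z))"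
      using S by blast
    then show ?thesis unfolding proj_zeros_def by blast
  qed
  then show ?thesis
    using S unfolding zariski_closed_def by (intro exI[of _ "\<Union>Z\<in>K. S Z"]) blast
qed

lemma openin_zariski:
  fixes U :: "(complex ^ 'n) set set"
  shows "openin zariski U \<longleftrightarrow> U \<subseteq> PP \<and> zariski_closed (PP - U)"
proof -
  have "istopology (\<lambda>U :: (complex ^ 'n) set set. U \<subseteq> PP \<and> zariski_closed (PP - U))"
    unfolding istopology_def
  proof (rule conjI; intro allI impI)
    fix S T :: "(complex ^ 'n) set set"
    assume S: "S \<subseteq> PP \<and> zariski_closed (PP - S)" and T: "T \<subseteq> PP \<and> zariski_closed (PP - T)"
    have "zariski_closed (PP - S \<inter> T)"
      unfolding Diff_Int using S T by (intro zariski_closed_Un) simp_all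
    then show "S \<inter> T \<subseteq> PP \<and> zariski_closed (PP - S \<inter> T)"
      using S by (simp add: le_infI1)
  next
    fix K :: "(complex ^ 'n) set set set"
    assume K: "\<forall>U\<in>K. U \<subseteq> PP \<and> zariski_closed (PP - U)"
    have "PP - \<Union>K = PP \<inter> \<Inter>((\<lambda>U. PP - U) ` K)" by blast
    moreover have "zariski_closed (PP \<inter> \<Inter>((\<lambda>U. PP - U) ` K))"
      by (rule zariski_closed_Inter) (use K in \<open>elim imageE, simp\<close>)
    ultimately show "\<Union>K \<subseteq> PP \<and> zariski_closed (PP - \<Union>K)"
      using K by (simp add: Sup_le_iff)
  qed
  from topology_inverse'[OF this] show ?thesis unfolding zariski_def by simp
qed

lemma form_one: "form 0 (\<lambda>_ :: complex ^ 'n. 1)"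
proof -
  have "{m :: 'n \<Rightarrow> nat. (\<Sum>i\<in>UNIV. m i) = 0} = {\<lambda>_. 0}" by auto
  then show ?thesis unfolding form_def by (intro exI[of _ "\<lambda>_. 1"]) simp
qed

lemma topspace_zariski: "topspace (zariski :: (complex ^ 'n) set topology) = PP"
proof -
  let ?S = "{\<lambda>_ :: complex ^ 'n. 1 :: complex}"
  have "P \<notin> proj_zeros ?S" for P :: "(complex ^ 'n) set"
  proof
    assume P: "P \<in> proj_zeros ?S"
    then obtain v where "P = vec.span {v}" unfolding proj_zeros_def proj_space_def by blast
    then have "v \<in> P" by (simp add: vec.span_base)
    then show False using P unfolding proj_zeros_def by simp
  qed
  then have "PP - PP = proj_zeros ?S" by blast
  then have "zariski_closed (PP - PP :: (complex ^ 'n) set set)"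
    unfolding zariski_closed_def using form_one by (intro exI[of _ ?S]) blast
  then have "openin zariski (PP :: (complex ^ 'n) set set)"
    by (simp add: openin_zariski)
  then have "PP \<subseteq> topspace (zariski :: (complex ^ 'n) set topology)"
    by (rule openin_subset)
  moreover have "topspace (zariski :: (complex ^ 'n) set topology) \<subseteq> PP"
    using openin_topspace openin_zariski by metis
  ultimately show ?thesis by (rule subset_antisym[rotated])
qed

lemma closedin_zariski:
  fixes Z :: "(complex ^ 'n) set set"
  shows "closedin zariski Z \<longleftrightarrow> zariski_closed Z"
proof -
  have sub: "Z \<subseteq> PP" if "zariski_closed Z"
    using that unfolding zariski_closed_def proj_zeros_def by force
  have "closedin zariski Z \<longleftrightarrow> Z \<subseteq> PP \<and> zariski_closed (PP - (PP - Z))"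
    unfolding closedin_def topspace_zariski openin_zariski by simp
  moreover have "PP - (PP - Z) = Z" if "Z \<subseteq> PP"
    using that by (rule double_diff) simp
  ultimately show ?thesis
    using sub by auto
qed

definition projective_variety :: "(complex ^ 'n) set set \<Rightarrow> bool" where
  "projective_variety X \<longleftrightarrow> closedin zariski X \<and> X \<noteq> {} \<and>
    (\<forall>A B. closedin zariski A \<and> closedin zariski B \<and> X \<subseteq> A \<union> B \<longrightarrow> X \<subseteq> A \<or> X \<subseteq> B)"


section \<open>Rational maps\<close>

text \<open>
  A rational map between projective varieties is represented by a tuple of forms of one common
  degree, and is taken to be defined where the forms of that tuple do not all vanish.
\<close>

definition defined_at :: "(complex ^ 'n \<Rightarrow> complex ^ 'm) \<Rightarrow> (complex ^ 'n) set \<Rightarrow> bool" where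
  "defined_at f P \<longleftrightarrow> (\<exists>v\<in>P. f v \<noteq> 0)"

definition proj_map :: "(complex ^ 'n \<Rightarrow> complex ^ 'm) \<Rightarrow> (complex ^ 'n) set \<Rightarrow> (complex ^ 'm) set" where
  "proj_map f P = vec.span (f ` P)"

definition zariski_dense :: "(complex ^ 'n) set set \<Rightarrow> (complex ^ 'n) set set \<Rightarrow> bool" where
  "zariski_dense U X \<longleftrightarrow> U \<subseteq> X \<and> X \<subseteq> zariski closure_of U"

definition rational_map ::
    "(complex ^ 'n) set set \<Rightarrow> (complex ^ 'm) set set \<Rightarrow> (complex ^ 'n \<Rightarrow> complex ^ 'm) \<Rightarrow> bool" where
  "rational_map X Y f \<longleftrightarrow>
    projective_variety X \<and> projective_variety Y \<and>
    (\<exists>d. \<forall>i. form d (\<lambda>v. f v $ i)) \<and>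
    zariski_dense {P \<in> X. defined_at f P} X \<and>
    proj_map f ` {P \<in> X. defined_at f P} \<subseteq> Y"

text \<open>The composition of \<open>f\<close> followed by \<open>g\<close> exists and is the identity, as a rational map on \<open>X\<close>.\<close>

definition rational_left_inverse ::
    "(complex ^ 'n) set set \<Rightarrow> (complex ^ 'n \<Rightarrow> complex ^ 'm) \<Rightarrow> (complex ^ 'm \<Rightarrow> complex ^ 'n) \<Rightarrow> bool" where
  "rational_left_inverse X f g \<longleftrightarrow>
    (let U = {P \<in> X. defined_at f P \<and> defined_at g (proj_map f P)}
     in zariski_dense U X \<and> (\<forall>P\<in>U. proj_map g (proj_map f P) = P))"

definition birational_with_inverse ::
    "(complex ^ 'n) set set \<Rightarrow> (complex ^ 'm) set set \<Rightarrow>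
     (complex ^ 'n \<Rightarrow> complex ^ 'm) \<Rightarrow> (complex ^ 'm \<Rightarrow> complex ^ 'n) \<Rightarrow> bool" where
  "birational_with_inverse X Y f g \<longleftrightarrow>
    rational_map X Y f \<and> rational_map Y X g \<and>
    rational_left_inverse X f g \<and> rational_left_inverse Y g f"

text \<open>
  The linear projection of \<open>P(W)\<close> from its linear subspace \<open>P(U)\<close> to a projective space
  \<open>P(complex ^ 'm)\<close>. Only the restriction of \<open>p\<close> to \<open>W\<close> matters. By surjectivity the target is
  identified with \<open>P(W/U)\<close>, and \<open>p\<close> is unique up to a linear automorphism of the target.
\<close>

definition linear_projection ::
    "(complex ^ 'n) set \<Rightarrow> (complex ^ 'n) set \<Rightarrow> (complex ^ 'n \<Rightarrow> complex ^ 'm) \<Rightarrow> bool" where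
  "linear_projection W U p \<longleftrightarrow>
    Vector_Spaces.linear (*s) (*s) p \<and> p ` W = UNIV \<and> {w \<in> W. p w = 0} = U"


section \<open>Linear systems and rational normal curves\<close>

definition forms_through :: "nat \<Rightarrow> (complex ^ 'n) set set \<Rightarrow> (complex ^ 'n \<Rightarrow> complex) set" where
  "forms_through d X = {f. form d f \<and> (\<forall>P\<in>X. \<forall>v\<in>P. f v = 0)}"

text \<open>
  \<open>\<phi>\<close> is the map to \<open>P(W)\<close> defined by the linear system \<open>L\<close>: its coordinates \<open>q\<close> with respect to
  some basis \<open>w\<close> of \<open>W\<close> form a basis of the vector space \<open>L\<close>.
\<close>

definition defined_by_system ::
    "(complex ^ 'm \<Rightarrow> complex) set \<Rightarrow> (complex ^ 'n) set \<Rightarrow> (complex ^ 'm \<Rightarrow> complex ^ 'n) \<Rightarrow> bool" where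
  "defined_by_system L W \<phi> \<longleftrightarrow>
    (\<exists>N (q :: nat \<Rightarrow> complex ^ 'm \<Rightarrow> complex) (w :: nat \<Rightarrow> complex ^ 'n).
       inj_on w {..<N} \<and> vec.independent (w ` {..<N}) \<and> vec.span (w ` {..<N}) = W \<and>
       (\<forall>i<N. q i \<in> L) \<and>
       (\<forall>f\<in>L. \<exists>!c. (\<forall>i\<ge>N. c i = 0) \<and> f = (\<lambda>y. \<Sum>i<N. c i * q i y)) \<and>
       (\<forall>y. \<phi> y = (\<Sum>i<N. q i y *s w i)))"

text \<open>
  The image of the \<open>d\<close>-th Veronese embedding of \<open>P\<^sup>1\<close> into the span of \<open>d + 1\<close> independent points.
\<close>

definition rational_normal_curve :: "nat \<Rightarrow> (complex ^ 'n) set set \<Rightarrow> bool" where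
  "rational_normal_curve d C \<longleftrightarrow>
    (\<exists>a :: nat \<Rightarrow> complex ^ 'n. inj_on a {..d} \<and> vec.independent (a ` {..d}) \<and>
       C = {vec.span {\<Sum>i\<le>d. (s ^ (d - i) * t ^ i) *s a i} | s t. (s, t) \<noteq> (0, 0)})"

abbreviation twisted_cubic :: "(complex ^ 'n) set set \<Rightarrow> bool" where
  "twisted_cubic \<equiv> rational_normal_curve 3"


section \<open>The exterior algebra\<close>

text \<open>
  The exterior algebra on a basis indexed by a finite linearly ordered type \<open>'n\<close>: the coordinate
  at \<open>{i\<^sub>1 < \<dots> < i\<^sub>k}\<close> is the coefficient of the product of the corresponding basis vectors in this
  order. \<open>shuffle_sign A B\<close> is the sign of the permutation sorting the elements of \<open>A\<close>
  followed by those of \<open>B\<close>.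
\<close>

type_synonym 'n ext = "complex ^ ('n set)"

definition shuffle_sign :: "'n::linorder set \<Rightarrow> 'n set \<Rightarrow> complex" where
  "shuffle_sign A B = (-1) ^ card {(i, j). i \<in> A \<and> j \<in> B \<and> j < i}"

definition wedge :: "('n::{finite,linorder}) ext \<Rightarrow> 'n ext \<Rightarrow> 'n ext" (infixr "\<and>\<^sub>\<Lambda>" 70) where
  "a \<and>\<^sub>\<Lambda> b = (\<chi> S. \<Sum>A\<in>Pow S. shuffle_sign A (S - A) * a $ A * b $ (S - A))"

definition ext_basis :: "'n \<Rightarrow> ('n::{finite,linorder}) ext" where
  "ext_basis i = axis {i} 1"

lemma ext_basis_wedge_axis:
  "ext_basis i \<and>\<^sub>\<Lambda> axis B c =
    (if i \<in> B then 0 else axis (insert i B) ((-1) ^ card {j \<in> B. j < i} * c))"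
proof -
  have "(ext_basis i \<and>\<^sub>\<Lambda> axis B c) $ S =
      (if i \<in> B then 0 else axis (insert i B) ((-1) ^ card {j \<in> B. j < i} * c)) $ S" for S
  proof -
    have "(ext_basis i \<and>\<^sub>\<Lambda> axis B c) $ S =
        (\<Sum>A\<in>Pow S. if A = {i} then shuffle_sign A (S - A) * axis B c $ (S - A) else 0)"
      unfolding wedge_def ext_basis_def vec_lambda_beta
      by (intro sum.cong refl) (simp add: axis_def)
    also have "\<dots> = (if i \<in> S then shuffle_sign {i} (S - {i}) * axis B c $ (S - {i}) else 0)"
      by (subst sum.delta) simp_all
    also have "\<dots> = (if i \<in> S \<and> S - {i} = B then (-1) ^ card {j \<in> B. j < i} * c else 0)"
    proof -
      have "{(k, j). k \<in> {i} \<and> j \<in> B \<and> j < k} = Pair i ` {j \<in> B. j < i}" by auto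
      then have "shuffle_sign {i} B = (-1) ^ card {j \<in> B. j < i}"
        unfolding shuffle_sign_def by (simp add: card_image inj_on_def)
      then show ?thesis by (auto simp: axis_def)
    qed
    also have "\<dots> = (if i \<in> B then 0 else axis (insert i B) ((-1) ^ card {j \<in> B. j < i} * c)) $ S"
    proof -
      have "i \<in> S \<and> S - {i} = B \<longleftrightarrow> i \<notin> B \<and> S = insert i B" by blast
      then show ?thesis by (simp add: axis_def)
    qed
    finally show ?thesis .
  qed
  then show ?thesis unfolding vec_eq_iff by blast
qed

lemma ext_basis_wedge_self: "ext_basis i \<and>\<^sub>\<Lambda> ext_basis i = 0"
  using ext_basis_wedge_axis[of i "{i}" 1] by (simp flip: ext_basis_def)

lemma ext_basis_anticommute:
  assumes "i \<noteq> j"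
  shows "ext_basis i \<and>\<^sub>\<Lambda> ext_basis j = - (ext_basis j \<and>\<^sub>\<Lambda> ext_basis i)"
proof -
  have "ext_basis i \<and>\<^sub>\<Lambda> ext_basis j = axis {i, j} (if j < i then -1 else 1)"
    if "i \<noteq> j" for i j :: 'a
  proof -
    have "{k \<in> {j}. k < i} = (if j < i then {j} else {})" by auto
    then show ?thesis
      using that ext_basis_wedge_axis[of i "{j}" 1] by (simp flip: ext_basis_def[of j])
  qed
  from this[OF assms] this[OF assms[symmetric]] show ?thesis
    using assms by (auto simp: vec_eq_iff axis_def insert_commute not_less dest: order.antisym)
qed

text \<open>
  The Grassmannian \<open>G(2,M)\<close> in its Pluecker embedding, for a subspace \<open>M\<close> of the degree one part.
\<close>

definition grassmannian2 :: "('n::{finite,linorder}) ext set \<Rightarrow> 'n ext set set" where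
  "grassmannian2 M = {vec.span {v \<and>\<^sub>\<Lambda> w} | v w. v \<in> M \<and> w \<in> M \<and> v \<and>\<^sub>\<Lambda> w \<noteq> 0}"


section \<open>The variety and its fourfold section\<close>

text \<open>
  In the index type \<open>7\<close> the numeral \<open>7\<close> denotes the same element as \<open>0\<close>, so that \<open>bx 7\<close> is the
  smallest basis vector in the order underlying \<open>wedge\<close>. This only affects which products of basis
  vectors carry a sign in coordinates.
\<close>

abbreviation bx :: "7 \<Rightarrow> 7 ext" where
  "bx \<equiv> ext_basis"

definition V7 :: "7 ext set" where
  "V7 = vec.span {bx 1, bx 2, bx 3, bx 4, bx 5, bx 6, bx 7}"

definition omega0 :: "7 ext" where
  "omega0 = bx 1 \<and>\<^sub>\<Lambda> bx 2 \<and>\<^sub>\<Lambda> bx 3 \<and>\<^sub>\<Lambda> bx 7 + bx 4 \<and>\<^sub>\<Lambda> bx 5 \<and>\<^sub>\<Lambda> bx 6 \<and>\<^sub>\<Lambda> bx 7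
          + bx 2 \<and>\<^sub>\<Lambda> bx 3 \<and>\<^sub>\<Lambda> bx 5 \<and>\<^sub>\<Lambda> bx 6 + bx 1 \<and>\<^sub>\<Lambda> bx 3 \<and>\<^sub>\<Lambda> bx 4 \<and>\<^sub>\<Lambda> bx 6"

definition hatG2 :: "7 ext set set" where
  "hatG2 = {vec.span {v \<and>\<^sub>\<Lambda> w} | v w. v \<in> V7 \<and> w \<in> V7 \<and> v \<and>\<^sub>\<Lambda> w \<noteq> 0 \<and> (v \<and>\<^sub>\<Lambda> w) \<and>\<^sub>\<Lambda> omega0 = 0}"

definition F4 :: "7 ext set set" where
  "F4 = hatG2 \<inter> grassmannian2 (vec.span {bx 2, bx 3, bx 4, bx 6, bx 7})"

end

theory Submission
  imports Defs
begin

text \<open>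
  A plane \<open>\<langle>v, w\<rangle>\<close> in \<open>V7\<close> has Pluecker coordinates \<open>p\<^sub>i\<^sub>j = v\<^sub>i w\<^sub>j - v\<^sub>j w\<^sub>i\<close>, and wedging with
  \<open>omega0\<close> gives seven linear equations between them, one for each index that can be missing from a
  sextuple (\<open>wedge_omega0_eq_0_iff\<close>). So the variety is cut out in the 14-dimensional space
  \<open>G2_span\<close> by the Pluecker relations. Its points in \<open>F4\<close> are the planes in
  \<open>\<langle>x\<^sub>2, x\<^sub>3, x\<^sub>4, x\<^sub>6, x\<^sub>7\<rangle>\<close>; they span the subspace where the six coordinates
  \<open>p\<^sub>1\<^sub>5, p\<^sub>1\<^sub>3, p\<^sub>1\<^sub>4, p\<^sub>1\<^sub>6, p\<^sub>1\<^sub>7, p\<^sub>3\<^sub>5\<close> vanish. Hence projecting from \<open>F4\<close> means reading off these six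
  coordinates, up to a linear change of coordinates in the target: this is \<open>\<pi>\<^sub>0\<close>.

  If \<open>p\<^sub>1\<^sub>5 \<noteq> 0\<close>, then the plane has a unique basis \<open>v, w\<close> with \<open>(v\<^sub>1, v\<^sub>5) = (1, 0)\<close> and
  \<open>(w\<^sub>1, w\<^sub>5) = (0, 1)\<close>. The equations then express all entries of \<open>v\<close> and \<open>w\<close> linearly through
  \<open>w\<^sub>3, w\<^sub>4, w\<^sub>6, w\<^sub>7, v\<^sub>3\<close>, so the chart \<open>p\<^sub>1\<^sub>5 \<noteq> 0\<close> is a five-dimensional affine space. Homogenizing
  \<open>v \<and> w\<close> with one more variable gives a map \<open>\<phi>\<^sub>0\<close> with quadratic coordinates, and
  \<open>\<phi>\<^sub>0 (\<pi>\<^sub>0 x) = p\<^sub>1\<^sub>5 x\<close>, \<open>\<pi>\<^sub>0 (\<phi>\<^sub>0 y) = y\<^sub>1 y\<close>: the two maps are inverse to each other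
  (\<open>\<phi>\<^sub>0_\<pi>\<^sub>0\<close>, \<open>\<pi>\<^sub>0_\<phi>\<^sub>0\<close>). The fourteen coordinates of \<open>\<phi>\<^sub>0\<close> are the six products \<open>y\<^sub>1 y\<^sub>i\<close>, the five further
  products \<open>y\<^sub>3 y\<^sub>i\<close>, and the minors of the matrix with rows \<open>(y\<^sub>6, y\<^sub>2, - y\<^sub>5)\<close> and \<open>(y\<^sub>2, - y\<^sub>5, - y\<^sub>4)\<close>
  up to sign. These form a basis of the quadrics through the twisted cubic that the minors define
  in \<open>y\<^sub>1 = y\<^sub>3 = 0\<close> (\<open>quadrics_through_cubic\<close>, \<open>quadrics_independent\<close>).

  Since a rational map has to be defined on a dense subset of an irreducible variety, the remaining
  point is that the chart \<open>p\<^sub>1\<^sub>5 \<noteq> 0\<close> is dense and that the variety is irreducible. Both follow once every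
  form that vanishes on the image of \<open>\<phi>\<^sub>0\<close> vanishes on the whole variety, and for this, forms being
  continuous, it suffices that every point of the affine cone is a limit, in the ordinary topology, of
  multiples of values of \<open>\<phi>\<^sub>0\<close> (\<open>G2_cone_subset_closure\<close>). Points which are not themselves such
  multiples correspond to planes containing a vector of the cone \<open>z\<^sub>7\<^sup>2 = - z\<^sub>3 z\<^sub>6\<close> in
  \<open>\<langle>x\<^sub>3, x\<^sub>6, x\<^sub>7\<rangle>\<close>. The conic and the twisted cubic are both parametrized by \<open>P\<^sup>1\<close>, so the vector determines a base point of
  \<open>\<phi>\<^sub>0\<close>, and the given point is a directional derivative of \<open>\<phi>\<^sub>0\<close> there
  (\<open>exceptional_in_closure\<close>).

  An arbitrary projection \<open>p\<close> from \<open>F4\<close> agrees on \<open>G2_span\<close> with \<open>A \<circ> \<pi>\<^sub>0\<close> for a linear automorphism \<open>A\<close>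
  (\<open>projection_factors\<close>), so the twisted cubic is moved by \<open>A\<close> and the inverse becomes \<open>\<phi>\<^sub>0 \<circ> A\<^sup>-\<^sup>1\<close>.
\<close>

section \<open>Homogeneous forms\<close>

lemma form_0_iff: "form 0 f \<longleftrightarrow> (\<exists>c. f = (\<lambda>_. c))"
proof -
  have E: "{m :: 'n::finite \<Rightarrow> nat. (\<Sum>i\<in>UNIV. m i) = 0} = {\<lambda>_. 0}" by auto
  show ?thesis unfolding form_def E by (auto simp: fun_eq_iff)
qed

lemma form_zero: "form d (\<lambda>_. 0)"
  unfolding form_def by (intro exI[of _ "\<lambda>_. 0"]) simp

lemma form_cmult:
  assumes "form d f"
  shows "form d (\<lambda>x. k * f x)"
proof -
  from assms obtain c where "\<And>x. f x = (\<Sum>m | (\<Sum>i\<in>UNIV. m i) = d. c m * (\<Prod>i\<in>UNIV. (x $ i) ^ m i))"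
    unfolding form_def by blast
  then show ?thesis
    unfolding form_def by (intro exI[of _ "\<lambda>m. k * c m"]) (simp add: sum_distrib_left mult.assoc)
qed

lemma form_uminus: "form d f \<Longrightarrow> form d (\<lambda>x. - f x)"
  using form_cmult[of d f "- 1"] by simp

lemma form_add:
  assumes "form d f" "form d g"
  shows "form d (\<lambda>x. f x + g x)"
proof -
  from assms(1) obtain c where "\<And>x. f x = (\<Sum>m | (\<Sum>i\<in>UNIV. m i) = d. c m * (\<Prod>i\<in>UNIV. (x $ i) ^ m i))"
    unfolding form_def by blast
  moreover from assms(2) obtain c' where "\<And>x. g x = (\<Sum>m | (\<Sum>i\<in>UNIV. m i) = d. c' m * (\<Prod>i\<in>UNIV. (x $ i) ^ m i))"
    unfolding form_def by blast
  ultimately show ?thesis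
    unfolding form_def by (intro exI[of _ "\<lambda>m. c m + c' m"]) (simp add: sum.distrib distrib_right)
qed

lemma form_diff: "form d f \<Longrightarrow> form d g \<Longrightarrow> form d (\<lambda>x. f x - g x)"
  using form_add[of d f "\<lambda>x. - g x"] form_uminus[of d g] by simp

lemma form_sum: "(\<And>i. i \<in> I \<Longrightarrow> form d (f i)) \<Longrightarrow> form d (\<lambda>x. \<Sum>i\<in>I. f i x)"
  by (induction I rule: infinite_finite_induct) (simp_all add: form_zero form_add)

lemma form_monomial: "form (\<Sum>i\<in>UNIV. m i) (\<lambda>x. \<Prod>i\<in>UNIV. (x $ i) ^ m i)"
  unfolding form_def
  by (intro exI[of _ "\<lambda>n. if n = m then 1 else 0"])
    (simp add: if_distrib[of "\<lambda>z. z * _"] finite_exponents cong: if_cong)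

lemma form_coord: "form 1 (\<lambda>x :: complex ^ 'n. x $ i)"
proof -
  have "(\<Prod>j\<in>UNIV. (x $ j) ^ (if j = i then 1 else 0)) = x $ i" for x :: "complex ^ 'n"
    by (simp add: if_distrib[of "power _"] cong: if_cong)
  then show ?thesis
    using form_monomial[of "\<lambda>j. if j = i then 1 else 0"] by simp
qed

text \<open>
  Choosing one variable to split off from every monomial makes induction on the degree available;
  substitution, continuity and restriction to lines are proved by it.
\<close>
lemma form_Suc_decompose:
  fixes f :: "complex ^ 'n \<Rightarrow> complex"
  assumes "form (Suc d) f"
  obtains g where "\<And>i. form d (g i)" "\<And>x. f x = (\<Sum>i\<in>UNIV. x $ i * g i x)"
proof -
  let ?E = "{m :: 'n \<Rightarrow> nat. (\<Sum>i\<in>UNIV. m i) = Suc d}"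
  let ?M = "\<lambda>m (x :: complex ^ 'n). \<Prod>i\<in>UNIV. (x $ i) ^ m i"
  obtain c where c: "\<And>x. f x = (\<Sum>m\<in>?E. c m * ?M m x)"
    using assms unfolding form_def by blast
  have "\<exists>i. m i > 0" if "m \<in> ?E" for m
  proof (rule ccontr)
    assume "\<nexists>i. m i > 0"
    then have "(\<Sum>i\<in>UNIV. m i) = 0" by simp
    with that show False by simp
  qed
  then obtain a where a: "\<And>m. m \<in> ?E \<Longrightarrow> m (a m) > 0" by metis
  define r where "r m = m(a m := m (a m) - 1)" for m :: "'n \<Rightarrow> nat"
  have M: "?M m x = x $ a m * ?M (r m) x" if "m \<in> ?E" for m x
  proof -
    have "?M m x = (x $ a m) ^ m (a m) * (\<Prod>i\<in>UNIV - {a m}. (x $ i) ^ m i)"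
      by (rule prod.remove) auto
    moreover have "?M (r m) x = (x $ a m) ^ (m (a m) - 1) * (\<Prod>i\<in>UNIV - {a m}. (x $ i) ^ r m i)"
      unfolding r_def by (subst prod.remove[of _ "a m"]) auto
    moreover have "(\<Prod>i\<in>UNIV - {a m}. (x $ i) ^ r m i) = (\<Prod>i\<in>UNIV - {a m}. (x $ i) ^ m i)"
      unfolding r_def by (rule prod.cong) auto
    moreover have "(x $ a m) ^ m (a m) = x $ a m * (x $ a m) ^ (m (a m) - 1)"
      using a[OF that] by (simp add: power_eq_if)
    ultimately show ?thesis by simp
  qed
  have r: "(\<Sum>i\<in>UNIV. r m i) = d" if "m \<in> ?E" for m
  proof -
    have "(\<Sum>i\<in>UNIV. m i) = m (a m) + (\<Sum>i\<in>UNIV - {a m}. m i)"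
      by (rule sum.remove) auto
    moreover have "(\<Sum>i\<in>UNIV. r m i) = m (a m) - 1 + (\<Sum>i\<in>UNIV - {a m}. r m i)"
      unfolding r_def by (subst sum.remove[of _ "a m"]) auto
    moreover have "(\<Sum>i\<in>UNIV - {a m}. r m i) = (\<Sum>i\<in>UNIV - {a m}. m i)"
      unfolding r_def by (rule sum.cong) auto
    ultimately show ?thesis using a[OF that] that by simp
  qed
  define g where "g i x = (\<Sum>m | m \<in> ?E \<and> a m = i. c m * ?M (r m) x)" for i x
  have "form d (g i)" for i
    unfolding g_def
  proof (intro form_sum form_cmult)
    fix m assume "m \<in> {m \<in> ?E. a m = i}"
    then have "(\<Sum>i\<in>UNIV. r m i) = d" using r by blast
    then show "form d (?M (r m))" using form_monomial[of "r m"] by simp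
  qed
  moreover have "f x = (\<Sum>i\<in>UNIV. x $ i * g i x)" for x
  proof -
    have "f x = (\<Sum>m\<in>?E. c m * (x $ a m * ?M (r m) x))"
      unfolding c
    proof (rule sum.cong[OF refl])
      fix m assume "m \<in> ?E"
      then show "c m * ?M m x = c m * (x $ a m * ?M (r m) x)" using M[of m x] by argo
    qed
    also have "\<dots> = (\<Sum>i\<in>UNIV. \<Sum>m | m \<in> ?E \<and> a m = i. c m * (x $ a m * ?M (r m) x))"
      by (rule sum.group[symmetric]) (auto simp: finite_exponents)
    also have "\<dots> = (\<Sum>i\<in>UNIV. x $ i * g i x)"
      unfolding g_def sum_distrib_left by (intro sum.cong) auto
    finally show ?thesis .
  qed
  ultimately show thesis using that by blast
qed

lemma form_compose:
  assumes "form d f" "\<And>i. form e (\<lambda>x. g x $ i)"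
  shows "form (d * e) (\<lambda>x. f (g x))"
  using assms(1)
proof (induction d arbitrary: f)
  case 0
  then show ?case by (auto simp: form_0_iff)
next
  case (Suc d)
  obtain h where h: "\<And>i. form d (h i)" "\<And>x. f x = (\<Sum>i\<in>UNIV. x $ i * h i x)"
    using form_Suc_decompose[OF Suc.prems] by blast
  have "form (e + d * e) (\<lambda>x. \<Sum>i\<in>UNIV. g x $ i * h i (g x))"
    using assms(2) Suc.IH[OF h(1)] by (intro form_sum form_mult)
  then show ?case by (simp add: h(2))
qed

lemma form_continuous_on:
  assumes "form d f"
  shows "continuous_on S f"
  using assms
proof (induction d arbitrary: f)
  case 0
  then show ?case by (auto simp: form_0_iff)
next
  case (Suc d)
  obtain h where h: "\<And>i. form d (h i)" "\<And>x. f x = (\<Sum>i\<in>UNIV. x $ i * h i x)"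
    using form_Suc_decompose[OF Suc.prems] by blast
  have "continuous_on S (\<lambda>x. \<Sum>i\<in>UNIV. x $ i * h i x)"
    using Suc.IH[OF h(1)] by (intro continuous_intros)
  then show ?case by (simp add: h(2))
qed

lemma form_on_line:
  assumes "form d f"
  shows "\<exists>q. \<forall>s. f (u + s *s v) = poly q s"
  using assms
proof (induction d arbitrary: f)
  case 0
  then obtain c where "f = (\<lambda>_. c)" by (auto simp: form_0_iff)
  then show ?case by (intro exI[of _ "[:c:]"]) simp
next
  case (Suc d)
  obtain h where h: "\<And>i. form d (h i)" "\<And>x. f x = (\<Sum>i\<in>UNIV. x $ i * h i x)"
    using form_Suc_decompose[OF Suc.prems] by blast
  obtain q where q: "\<And>i s. h i (u + s *s v) = poly (q i) s"
    using Suc.IH[OF h(1)] by metis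
  have "f (u + s *s v) = poly (\<Sum>i\<in>UNIV. [:u $ i, v $ i:] * q i) s" for s
    unfolding h(2) q poly_sum by (simp add: algebra_simps)
  then show ?case by blast
qed

text \<open>
  On the line joining the two points both forms become nonzero polynomials in one variable, and so
  does their product.
\<close>
lemma forms_nonzero_simultaneously:
  assumes "form d f" "form e g" "f u \<noteq> 0" "g v \<noteq> 0"
  shows "\<exists>w. f w \<noteq> 0 \<and> g w \<noteq> 0"
proof -
  obtain q where q: "\<And>s. f (u + s *s (v - u)) = poly q s"
    using form_on_line[OF assms(1)] by metis
  obtain r where r: "\<And>s. g (u + s *s (v - u)) = poly r s"
    using form_on_line[OF assms(2)] by metis
  have "q \<noteq> 0" using q[of 0] assms(3) by auto
  moreover have "r \<noteq> 0" using r[of 1] assms(4) by auto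
  ultimately have "q * r \<noteq> 0" by simp
  then obtain s where "poly (q * r) s \<noteq> 0"
    using poly_all_0_iff_0 by blast
  then show ?thesis using q r by (metis mult_eq_0_iff poly_mult)
qed

lemma form_eq_0_on_closure:
  assumes "form d f" "\<And>x. x \<in> S \<Longrightarrow> f x = 0" "x \<in> closure S"
  shows "f x = 0"
  using continuous_constant_on_closure[OF form_continuous_on[OF assms(1)] assms(2,3)] .

lemma form_linear:
  assumes "Vector_Spaces.linear (*s) (*s) g"
  shows "form 1 (\<lambda>x. g x $ i)"
proof -
  have "form 1 (\<lambda>x. \<Sum>j\<in>UNIV. g (axis j 1) $ i * x $ j)"
    by (intro form_sum form_cmult form_coord)
  moreover have "(\<Sum>j\<in>UNIV. g (axis j 1) $ i * x $ j) = g x $ i" for x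
    using matrix_works[OF assms, of x, symmetric]
    by (simp add: matrix_vector_mult_def matrix_def)
  ultimately show ?thesis by simp
qed

section \<open>Points, irreducibility and density\<close>

lemma form_zero_on_line:
  assumes "form d f"
  shows "(\<forall>u\<in>vec.span {v}. f u = 0) \<longleftrightarrow> f v = 0"
  using assms by (auto simp: vec.span_singleton form_scale intro: vec.span_base)

lemma span_in_PP: "v \<noteq> 0 \<Longrightarrow> vec.span {v} \<in> PP"
  unfolding proj_space_def by blast

lemma proj_spaceE:
  assumes "P \<in> proj_space K"
  obtains v where "v \<in> K" "v \<noteq> 0" "P = vec.span {v}"
  using assms unfolding proj_space_def by blast

lemma span_singleton_scale:
  assumes "k \<noteq> 0"
  shows "vec.span {k *s v} = vec.span {v :: complex ^ 'n}"
proof -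
  have "l *s v = (l / k) *s (k *s v)" for l using assms by (simp add: vector_smult_assoc)
  then have "v \<in> vec.span {k *s v}" unfolding vec.span_singleton by (metis rangeI vector_smult_lid)
  then show ?thesis by (simp add: vec.span_eq vec.span_base vec.span_scale)
qed

lemma proj_zeros_iff:
  assumes "\<And>f. f \<in> S \<Longrightarrow> \<exists>d. form d f" "v \<noteq> 0"
  shows "vec.span {v} \<in> proj_zeros S \<longleftrightarrow> (\<forall>f\<in>S. f v = 0)"
  using form_zero_on_line assms(1) span_in_PP[OF assms(2)] unfolding proj_zeros_def by blast

lemma zariski_closed_proj_zeros:
  "(\<And>f. f \<in> S \<Longrightarrow> \<exists>d. form d f) \<Longrightarrow> zariski_closed (proj_zeros S)"
  unfolding zariski_closed_def by blast

text \<open>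
  If two closed sets cover the variety and neither contains it, then for each of them there is a form that
  vanishes on it but not on the whole cone. By density neither form vanishes on the image of \<open>\<Phi>\<close>, so the
  pullbacks along \<open>\<Phi>\<close> are nonzero, and they are nonzero at a common point. Density in the Euclidean topology
  is enough because forms are continuous.
\<close>
lemma projective_variety_parametrized:
  assumes closed: "zariski_closed (proj_space K)"
    and x0: "x0 \<in> K" "x0 \<noteq> 0"
    and form: "\<And>i. form e (\<lambda>y. \<Phi> y $ i)"
    and range: "range \<Phi> \<subseteq> K"
    and dense: "K \<subseteq> closure {k *s \<Phi> y | k y. True}"
  shows "projective_variety (proj_space K)"
proof -
  have nonzero: "\<exists>d h y. form d h \<and> h (\<Phi> y) \<noteq> 0 \<and> (\<forall>v\<in>K. h v \<noteq> 0 \<longrightarrow> v \<noteq> 0 \<and> vec.span {v} \<notin> A)"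
    if A: "closedin zariski A" "\<not> proj_space K \<subseteq> A" for A
  proof -
    obtain S where S: "\<forall>f\<in>S. \<exists>d. form d f" "A = proj_zeros S"
      using A(1) unfolding closedin_zariski zariski_closed_def by blast
    obtain x where x: "x \<in> K" "x \<noteq> 0" "vec.span {x} \<notin> A"
      using A(2) by (blast elim: proj_spaceE)
    then obtain f where f: "f \<in> S" "f x \<noteq> 0"
      using proj_zeros_iff[of S x] S by blast
    obtain i where i: "x $ i \<noteq> 0"
      using x(2) by (auto simp: vec_eq_iff)
    \<comment> \<open>The extra factor makes \<open>h\<close> vanish at the origin, which is not a point, even if \<open>f\<close> is constant.\<close>
    define h where "h v = v $ i * f v" for v
    obtain d where d: "form d f" using f S by blast
    have h: "form (1 + d) h"
      unfolding h_def using form_mult[OF form_coord d] .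
    have "\<exists>y. h (\<Phi> y) \<noteq> 0"
    proof (rule ccontr)
      assume "\<nexists>y. h (\<Phi> y) \<noteq> 0"
      then have "h v = 0" if "v \<in> {k *s \<Phi> y | k y. True}" for v
        using that form_scale[OF h] by auto
      then have "h x = 0"
        using form_eq_0_on_closure[OF h] dense x(1) by blast
      then show False using i f(2) by (simp add: h_def)
    qed
    moreover have "v \<noteq> 0 \<and> vec.span {v} \<notin> A" if "h v \<noteq> 0" for v
    proof
      show v: "v \<noteq> 0" using that by (auto simp: h_def)
      show "vec.span {v} \<notin> A"
        using proj_zeros_iff[of S v] S v f(1) that by (auto simp: h_def)
    qed
    ultimately show ?thesis using h by blast
  qed
  show ?thesis unfolding projective_variety_def
  proof (intro conjI allI impI)
    show "closedin zariski (proj_space K)" using closed by (simp add: closedin_zariski)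
    show "proj_space K \<noteq> {}" using x0 unfolding proj_space_def by blast
    fix A B assume AB: "closedin zariski A \<and> closedin zariski B \<and> proj_space K \<subseteq> A \<union> B"
    show "proj_space K \<subseteq> A \<or> proj_space K \<subseteq> B"
    proof (rule ccontr)
      assume "\<not> (proj_space K \<subseteq> A \<or> proj_space K \<subseteq> B)"
      then obtain d h y d' h' y' where h: "form d h" "h (\<Phi> y) \<noteq> 0" "\<And>v. v \<in> K \<Longrightarrow> h v \<noteq> 0 \<Longrightarrow> v \<noteq> 0 \<and> vec.span {v} \<notin> A"
        and h': "form d' h'" "h' (\<Phi> y') \<noteq> 0" "\<And>v. v \<in> K \<Longrightarrow> h' v \<noteq> 0 \<Longrightarrow> v \<noteq> 0 \<and> vec.span {v} \<notin> B"
        using nonzero[of A] nonzero[of B] AB by metis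
      obtain z where z: "h (\<Phi> z) \<noteq> 0" "h' (\<Phi> z) \<noteq> 0"
        using forms_nonzero_simultaneously[of "d * e" "\<lambda>y. h (\<Phi> y)" "d' * e" "\<lambda>y. h' (\<Phi> y)"]
          form_compose[OF h(1) form] form_compose[OF h'(1) form] h(2) h'(2) by blast
      have "\<Phi> z \<in> K" using range by blast
      then have "vec.span {\<Phi> z} \<in> proj_space K" "vec.span {\<Phi> z} \<notin> A \<union> B"
        using h(3) h'(3) z unfolding proj_space_def by blast+
      then show False using AB by blast
    qed
  qed
qed

lemma projective_variety_PP: "projective_variety (PP :: (complex ^ 'n) set set)"
proof (rule projective_variety_parametrized[where \<Phi> = "\<lambda>y. y" and e = 1])
  show "zariski_closed (PP :: (complex ^ 'n) set set)"
    using topspace_zariski closedin_topspace closedin_zariski by metis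
  show "axis undefined 1 \<noteq> (0 :: complex ^ 'n)" by (simp add: axis_eq_0_iff)
  have "UNIV = {k *s y | k (y :: complex ^ 'n). True}"
    by (metis (mono_tags, lifting) UNIV_eq_I mem_Collect_eq vector_smult_lid)
  then show "UNIV \<subseteq> closure {k *s y | k (y :: complex ^ 'n). True}"
    using closure_subset by metis
qed (use form_coord in auto)

text \<open>
  \<open>X\<close> is covered by the zero locus of \<open>h\<close> and the closure of \<open>U\<close>, and it is not contained in the
  first.
\<close>
lemma zariski_dense_nonzero_locus:
  assumes X: "projective_variety X" and h: "form d h"
    and P: "P \<in> X" "v \<in> P" "h v \<noteq> 0"
    and U: "U \<subseteq> X" "\<And>P. P \<in> X \<Longrightarrow> (\<exists>v\<in>P. h v \<noteq> 0) \<Longrightarrow> P \<in> U"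
  shows "zariski_dense U X"
proof -
  have XPP: "X \<subseteq> PP"
    using X closedin_subset topspace_zariski unfolding projective_variety_def by metis
  then have "U \<subseteq> zariski closure_of U"
    using U(1) closure_of_subset topspace_zariski by (metis subset_trans)
  then have "X \<subseteq> proj_zeros {h} \<union> zariski closure_of U"
    using U(2) XPP unfolding proj_zeros_def by blast
  moreover have "closedin zariski (proj_zeros {h})"
    using h by (auto simp: closedin_zariski intro: zariski_closed_proj_zeros)
  moreover have "\<not> X \<subseteq> proj_zeros {h}"
    using P unfolding proj_zeros_def by blast
  ultimately have "X \<subseteq> zariski closure_of U"
    using X unfolding projective_variety_def by (meson closedin_closure_of)
  then show ?thesis using U(1) unfolding zariski_dense_def by blast
qed

lemma proj_map_span:
  assumes "\<And>i. form d (\<lambda>v. f v $ i)"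
  shows "proj_map f (vec.span {v}) = vec.span {f v}"
proof -
  have f: "f (k *s v) = k ^ d *s f v" for k
    using form_scale[OF assms] by (simp add: vec_eq_iff)
  have "vec.span (f ` vec.span {v}) = vec.span {f v}"
  proof (rule subset_antisym)
    show "vec.span (f ` vec.span {v}) \<subseteq> vec.span {f v}"
      by (rule vec.span_minimal) (auto simp: vec.span_singleton[of v] f simp del: vector_smult_assoc intro!: vec.span_scale[OF vec.span_base])
    show "vec.span {f v} \<subseteq> vec.span (f ` vec.span {v})"
      by (rule vec.span_mono) (auto intro: vec.span_base)
  qed
  then show ?thesis unfolding proj_map_def .
qed

lemma defined_at_span:
  assumes "\<And>i. form d (\<lambda>v. f v $ i)"
  shows "defined_at f (vec.span {v}) \<longleftrightarrow> f v \<noteq> 0"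
proof -
  have "f (k *s v) = k ^ d *s f v" for k
    using form_scale[OF assms] by (simp add: vec_eq_iff)
  then show ?thesis
    unfolding defined_at_def by (auto simp: vec.span_singleton intro: exI[of _ 1])
qed

section \<open>Indices\<close>

lemma UNIV_7: "(UNIV :: 7 set) = {1, 2, 3, 4, 5, 6, 7}"
proof -
  have "card {1, 2, 3, 4, 5, 6, 7 :: 7} = CARD(7)" by simp
  then show ?thesis by (metis card_eq_UNIV_imp_eq_UNIV finite)
qed

lemma all_7: "(\<forall>i :: 7. P i) \<longleftrightarrow> P 1 \<and> P 2 \<and> P 3 \<and> P 4 \<and> P 5 \<and> P 6 \<and> P 7"
proof -
  have "(\<forall>i. P i) \<longleftrightarrow> (\<forall>i\<in>UNIV. P i)" by simp
  then show ?thesis unfolding UNIV_7 by simp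
qed

text \<open>
  The order of the index type compares the representatives \<open>0, \<dots>, 6\<close>; these rules let the simplifier
  decide it on numerals, with \<open>7\<close> represented by \<open>0\<close>.
\<close>
lemmas order_7 = less_bit1_def bit1.Rep_numeral bit1.Rep_1

section \<open>Bivectors and Pluecker coordinates\<close>

definition degree_one :: "('n \<Rightarrow> complex) \<Rightarrow> ('n::{finite,linorder}) ext" where
  "degree_one f = (\<Sum>i\<in>UNIV. f i *s ext_basis i)"

text \<open>
  The signs make the coordinates antisymmetric in \<open>i\<close> and \<open>j\<close>, so that formulas in them do not depend on
  the order of the index type, in which \<open>7\<close> comes first.
\<close>
definition pluecker :: "('n::{finite,linorder}) ext \<Rightarrow> 'n \<Rightarrow> 'n \<Rightarrow> complex" where
  "pluecker x i j = (if i < j then x $ {i, j} else if j < i then - x $ {i, j} else 0)"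

definition bivectors :: "('n::{finite,linorder}) ext set" where
  "bivectors = {x. \<forall>S. card S \<noteq> 2 \<longrightarrow> x $ S = 0}"

lemma degree_one_nth: "degree_one f $ {i} = f i"
  unfolding degree_one_def ext_basis_def by (simp add: axis_def if_distrib cong: if_cong)

lemma degree_one_nth_0: "card S \<noteq> 1 \<Longrightarrow> degree_one f $ S = 0"
  unfolding degree_one_def ext_basis_def by (auto simp: axis_def intro!: sum.neutral)

lemma degree_one_add: "degree_one f + degree_one g = degree_one (\<lambda>i. f i + g i)"
  unfolding degree_one_def by (simp add: sum.distrib vec.scale_left_distrib)

lemma degree_one_scale: "k *s degree_one f = degree_one (\<lambda>i. k * f i)"
  unfolding degree_one_def by (simp add: vec.scale_sum_right)

lemma degree_one_basis: "ext_basis i = degree_one (\<lambda>j. if j = i then 1 else 0)"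
  unfolding degree_one_def by (simp add: if_distrib[of "\<lambda>c. c *s _"] cong: if_cong)

lemma span_ext_basis:
  "vec.span (ext_basis ` I) = {degree_one f | f. \<forall>i. i \<notin> I \<longrightarrow> f i = 0}" (is "_ = ?R")
proof (rule subset_antisym)
  have "vec.subspace ?R"
  proof (rule vec.subspaceI)
    have "degree_one (\<lambda>_. 0) = 0" unfolding degree_one_def by simp
    then show "0 \<in> ?R" by force
    show "x + y \<in> ?R" if "x \<in> ?R" "y \<in> ?R" for x y
      using that by (force simp: degree_one_add)
    show "c *s x \<in> ?R" if "x \<in> ?R" for c x
      using that by (force simp: degree_one_scale)
  qed
  moreover have "ext_basis ` I \<subseteq> ?R"
    by (force simp: degree_one_basis)
  ultimately show "vec.span (ext_basis ` I) \<subseteq> ?R" by (rule vec.span_minimal[rotated])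
  show "?R \<subseteq> vec.span (ext_basis ` I)"
  proof clarify
    fix f :: "'a \<Rightarrow> complex" assume f: "\<forall>i. i \<notin> I \<longrightarrow> f i = 0"
    then have "f i *s ext_basis i \<in> vec.span (ext_basis ` I)" for i
      by (cases "i \<in> I") (auto intro: vec.span_scale vec.span_base vec.span_zero)
    then show "degree_one f \<in> vec.span (ext_basis ` I)"
      unfolding degree_one_def by (intro vec.span_sum)
  qed
qed

lemma shuffle_sign_empty: "shuffle_sign {} B = 1" "shuffle_sign A {} = 1"
  by (simp_all add: shuffle_sign_def)

text \<open>
  Together with the next lemma this evaluates the signs of products of explicit basis vectors. It is
  restricted to two elements so that rewriting with it terminates.
\<close>
lemma shuffle_sign_doubleton:
  fixes B :: "'n::{finite,linorder} set"
  assumes "i \<noteq> j"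
  shows "shuffle_sign {i, j} B = shuffle_sign {i} B * shuffle_sign {j} B"
proof -
  have "{(a, b). a \<in> {i, j} \<and> b \<in> B \<and> b < a} =
      {(a, b). a \<in> {i} \<and> b \<in> B \<and> b < a} \<union> {(a, b). a \<in> {j} \<and> b \<in> B \<and> b < a}"
    by auto
  moreover have "card \<dots> = card {(a, b). a \<in> {i} \<and> b \<in> B \<and> b < a} + card {(a, b). a \<in> {j} \<and> b \<in> B \<and> b < a}"
    by (rule card_Un_disjoint) (use assms in auto)
  ultimately show ?thesis unfolding shuffle_sign_def by (simp add: power_add)
qed

lemma shuffle_sign_insert_right:
  fixes B :: "'n::{finite,linorder} set"
  assumes "b \<notin> B"
  shows "shuffle_sign {i} (insert b B) = (if b < i then - 1 else 1) * shuffle_sign {i} B"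
proof -
  have "{(a, c). a \<in> {i} \<and> c \<in> insert b B \<and> c < a} =
      (if b < i then {(i, b)} else {}) \<union> {(a, c). a \<in> {i} \<and> c \<in> B \<and> c < a}"
    by auto
  moreover have "card \<dots> = (if b < i then 1 else 0) + card {(a, c). a \<in> {i} \<and> c \<in> B \<and> c < a}"
    by (subst card_Un_disjoint) (use assms in auto)
  ultimately show ?thesis unfolding shuffle_sign_def by (simp add: power_add)
qed

lemma wedge_degree_one_nth:
  assumes "i < j"
  shows "(degree_one f \<and>\<^sub>\<Lambda> degree_one g) $ {i, j} = f i * g j - f j * g i"
proof -
  have P: "Pow {i, j} = {{}, {i}, {j}, {i, j}}" by auto
  have D: "{i, j} - {i} = {j}" "{i, j} - {j} = {i}" using assms by auto
  have "i \<noteq> j" "\<not> j < i" using assms by auto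
  then show ?thesis
    using assms unfolding wedge_def vec_lambda_beta P
    by (simp add: D degree_one_nth degree_one_nth_0 shuffle_sign_insert_right[of _ "{}", simplified] shuffle_sign_empty doubleton_eq_iff)
qed

lemma wedge_degree_one_bivector: "degree_one f \<and>\<^sub>\<Lambda> degree_one g \<in> bivectors"
proof -
  have "shuffle_sign A (S - A) * degree_one f $ A * degree_one g $ (S - A) = 0" if "card S \<noteq> 2" "A \<subseteq> S" for S A
  proof (rule ccontr)
    assume "shuffle_sign A (S - A) * degree_one f $ A * degree_one g $ (S - A) \<noteq> 0"
    then have "card A = 1" "card (S - A) = 1" using degree_one_nth_0 by fastforce+
    moreover have "card S = card A + card (S - A)"
      using that(2) card_Un_disjoint[of A "S - A"] by (simp add: Un_absorb1)
    ultimately show False using that(1) by simp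
  qed
  then have "(degree_one f \<and>\<^sub>\<Lambda> degree_one g) $ S = 0" if "card S \<noteq> 2" for S
    unfolding wedge_def vec_lambda_beta using that by (intro sum.neutral) auto
  then show ?thesis unfolding bivectors_def by blast
qed

lemma pluecker_wedge: "pluecker (degree_one f \<and>\<^sub>\<Lambda> degree_one g) i j = f i * g j - f j * g i"
proof (cases i j rule: linorder_cases)
  case greater
  then have "\<not> i < j" by simp
  with greater show ?thesis using wedge_degree_one_nth[of j i f g] by (simp add: pluecker_def insert_commute)
qed (simp_all add: pluecker_def wedge_degree_one_nth)

lemma pluecker_swap: "pluecker x j i = - pluecker x i j"
  by (auto simp: pluecker_def insert_commute)

lemma pluecker_self: "pluecker x i i = 0"
  by (simp add: pluecker_def)

lemma pluecker_lin:
  "pluecker 0 i j = 0"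
  "pluecker (x + y) i j = pluecker x i j + pluecker y i j"
  "pluecker (x - y) i j = pluecker x i j - pluecker y i j"
  "pluecker (c *s x) i j = c * pluecker x i j"
  "pluecker (- x) i j = - pluecker x i j"
  by (simp_all add: pluecker_def)

lemma subspace_bivectors: "vec.subspace bivectors"
  by (rule vec.subspaceI) (auto simp: bivectors_def)

lemma bivector_nth: "i \<noteq> j \<Longrightarrow> x $ {i, j} = (if i < j then pluecker x i j else - pluecker x i j)"
  by (auto simp: pluecker_def)

lemma bivector_eqI:
  assumes "x \<in> bivectors" "y \<in> bivectors" "\<And>i j. pluecker x i j = pluecker y i j"
  shows "x = y"
proof -
  have "x $ S = y $ S" for S
  proof (cases "card S = 2")
    case True
    then obtain i j where "S = {i, j}" "i \<noteq> j" by (auto simp: card_2_iff)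
    then show ?thesis by (simp add: bivector_nth assms(3))
  next
    case False
    then show ?thesis using assms(1,2) by (simp add: bivectors_def)
  qed
  then show ?thesis by (simp add: vec_eq_iff)
qed

lemma form_pluecker: "form 1 (\<lambda>x. pluecker x i j)"
proof (cases i j rule: linorder_cases)
  case greater
  then have "(\<lambda>x. pluecker x i j) = (\<lambda>x. - x $ {i, j})"
    by (auto simp: pluecker_def fun_eq_iff)
  then show ?thesis using form_uminus[OF form_coord] by metis
qed (use form_coord form_zero in \<open>auto simp: pluecker_def\<close>)

text \<open>
  If \<open>p\<^sub>i\<^sub>j \<noteq> 0\<close>, then the rows \<open>i\<close> and \<open>j\<close> of the antisymmetric matrix \<open>p\<close> span the plane: for them
  \<open>p\<^sub>i\<^sub>k p\<^sub>j\<^sub>l - p\<^sub>i\<^sub>l p\<^sub>j\<^sub>k = p\<^sub>i\<^sub>j p\<^sub>k\<^sub>l\<close> is one of the Pluecker relations.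
\<close>
lemma decomposable_if_pluecker_relations:
  assumes x: "x \<in> bivectors"
    and rel: "\<And>i j k l. pluecker x i j * pluecker x k l - pluecker x i k * pluecker x j l + pluecker x i l * pluecker x j k = 0"
  obtains f g where "x = degree_one f \<and>\<^sub>\<Lambda> degree_one g"
proof (cases "\<forall>i j. pluecker x i j = 0")
  case True
  then have "x = degree_one (\<lambda>_. 0) \<and>\<^sub>\<Lambda> degree_one (\<lambda>_. 0)"
    by (intro bivector_eqI x wedge_degree_one_bivector) (simp add: pluecker_wedge)
  then show thesis by (rule that)
next
  case False
  then obtain i j where ij: "pluecker x i j \<noteq> 0" by blast
  have "x = degree_one (\<lambda>k. pluecker x i k / pluecker x i j) \<and>\<^sub>\<Lambda> degree_one (pluecker x j)"
  proof (intro bivector_eqI x wedge_degree_one_bivector)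
    fix k l
    show "pluecker x k l = pluecker (degree_one (\<lambda>k. pluecker x i k / pluecker x i j) \<and>\<^sub>\<Lambda> degree_one (pluecker x j)) k l"
      unfolding pluecker_wedge using rel[of i j k l] ij by (simp add: field_simps)
  qed
  then show thesis by (rule that)
qed

lemma wedge_add_right: "a \<and>\<^sub>\<Lambda> (b + c) = a \<and>\<^sub>\<Lambda> b + a \<and>\<^sub>\<Lambda> c"
  by (simp add: wedge_def vec_eq_iff sum.distrib algebra_simps)

lemma wedge_axis_nth:
  "(a \<and>\<^sub>\<Lambda> axis B c) $ S = (if B \<subseteq> S then shuffle_sign (S - B) B * c * a $ (S - B) else 0)"
proof -
  have "(a \<and>\<^sub>\<Lambda> axis B c) $ S =
      (\<Sum>A\<in>Pow S. if B \<subseteq> S \<and> A = S - B then shuffle_sign (S - B) B * c * a $ (S - B) else 0)"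
    unfolding wedge_def vec_lambda_beta
  proof (rule sum.cong[OF refl])
    fix A assume "A \<in> Pow S"
    then have "S - A = B \<longleftrightarrow> B \<subseteq> S \<and> A = S - B" by auto
    moreover from this have "S - (S - B) = B" if "S - A = B" using that by blast
    ultimately show "shuffle_sign A (S - A) * a $ A * axis B c $ (S - A) =
        (if B \<subseteq> S \<and> A = S - B then shuffle_sign (S - B) B * c * a $ (S - B) else 0)"
      by (auto simp: axis_def)
  qed
  also have "\<dots> = (if B \<subseteq> S then shuffle_sign (S - B) B * c * a $ (S - B) else 0)"
    by (cases "B \<subseteq> S") simp_all
  finally show ?thesis .
qed

section \<open>Equations of the variety\<close>

lemma ext_basis_wedge_axis':
  "ext_basis i \<and>\<^sub>\<Lambda> axis B c = (if i \<in> B then 0 else axis (insert i B) (shuffle_sign {i} B * c))"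
proof -
  have "{(k, j). k \<in> {i} \<and> j \<in> B \<and> j < k} = Pair i ` {j \<in> B. j < i}" by auto
  then have "shuffle_sign {i} B = (-1) ^ card {j \<in> B. j < i}"
    unfolding shuffle_sign_def by (simp add: card_image inj_on_def)
  then show ?thesis by (simp add: ext_basis_wedge_axis)
qed

lemma ext_basis_wedge_ext_basis:
  "ext_basis i \<and>\<^sub>\<Lambda> ext_basis j = (if i = j then 0 else axis {i, j} (shuffle_sign {i} {j}))"
  unfolding ext_basis_def[of j] by (simp add: ext_basis_wedge_axis')

lemma omega0_axis:
  "omega0 = axis {1, 2, 3, 7} (- 1) + axis {4, 5, 6, 7} (- 1) + axis {2, 3, 5, 6} 1 + axis {1, 3, 4, 6} 1"
  unfolding omega0_def
  by (simp add: ext_basis_wedge_ext_basis ext_basis_wedge_axis' shuffle_sign_insert_right shuffle_sign_empty order_7)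

definition G2_equations :: "7 ext \<Rightarrow> bool" where
  "G2_equations x \<longleftrightarrow>
     pluecker x 1 2 = 0 \<and> pluecker x 4 5 = 0 \<and> pluecker x 2 5 = - pluecker x 1 4 \<and>
     pluecker x 5 7 = pluecker x 1 3 \<and> pluecker x 5 6 = - pluecker x 1 7 \<and>
     pluecker x 4 7 = - pluecker x 2 3 \<and> pluecker x 4 6 = pluecker x 2 7"

lemma card_6_7: "card (S :: 7 set) = 6 \<longleftrightarrow> (\<exists>k. S = - {k})"
proof
  assume "card S = 6"
  then have "card (- S) = 1" by (simp add: Compl_eq_Diff_UNIV card_Diff_subset)
  then obtain k where "- S = {k}" by (auto simp: card_1_singleton_iff)
  then show "\<exists>k. S = - {k}" by (metis double_complement)
qed (auto simp: Compl_eq_Diff_UNIV card_Diff_subset)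

text \<open>
  Only the coordinates at the complements of single indices matter, by degree. At the complement
  of \<open>k\<close>, a monomial of \<open>omega0\<close> contributes if it does not involve \<open>k\<close>, with the Pluecker coordinate at the
  two remaining indices.
\<close>
lemma wedge_omega0_eq_0_iff:
  assumes "x \<in> bivectors"
  shows "x \<and>\<^sub>\<Lambda> omega0 = 0 \<longleftrightarrow> G2_equations x"
proof -
  have "(x \<and>\<^sub>\<Lambda> omega0) $ S = 0" if "card S \<noteq> 6" for S
  proof -
    have "x $ (S - B) = 0" if "card B = 4" "B \<subseteq> S" for B
    proof -
      have "card (S - B) = card S - 4" using that by (simp add: card_Diff_subset)
      moreover have "card S \<ge> 4" using that card_mono[of S B] by simp
      ultimately have "card (S - B) \<noteq> 2" using \<open>card S \<noteq> 6\<close> by simp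
      then show ?thesis using assms by (simp add: bivectors_def)
    qed
    then show ?thesis unfolding omega0_axis wedge_add_right
      by (simp add: wedge_axis_nth)
  qed
  then have "x \<and>\<^sub>\<Lambda> omega0 = 0 \<longleftrightarrow> (\<forall>k. (x \<and>\<^sub>\<Lambda> omega0) $ (- {k}) = 0)"
    unfolding vec_eq_iff by (metis card_6_7 zero_index)
  also have "\<dots> \<longleftrightarrow> G2_equations x"
    unfolding all_7 Compl_eq_Diff_UNIV UNIV_7 omega0_axis wedge_add_right vector_add_component wedge_axis_nth
    by (simp add: insert_Diff_if shuffle_sign_doubleton shuffle_sign_insert_right shuffle_sign_empty
          bivector_nth order_7)
       (auto simp: G2_equations_def eq_neg_iff_add_eq_0 neg_eq_iff_add_eq_0 add.commute)
  finally show ?thesis .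
qed

definition G2_span :: "7 ext set" where
  "G2_span = {x \<in> bivectors. G2_equations x}"

text \<open>
  The affine cone over the variety, including the origin.
\<close>
definition G2_cone :: "7 ext set" where
  "G2_cone = {degree_one f \<and>\<^sub>\<Lambda> degree_one g | f g. G2_equations (degree_one f \<and>\<^sub>\<Lambda> degree_one g)}"

lemma V7_eq: "V7 = range degree_one"
proof -
  have "V7 = vec.span (bx ` UNIV)" unfolding V7_def UNIV_7 by simp
  then show ?thesis unfolding span_ext_basis by auto
qed

lemma hatG2_eq: "hatG2 = proj_space G2_cone"
  unfolding hatG2_def proj_space_def G2_cone_def V7_eq
  by (auto simp: wedge_omega0_eq_0_iff[OF wedge_degree_one_bivector])
     (metis wedge_omega0_eq_0_iff[OF wedge_degree_one_bivector] rangeI)+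

lemma G2_cone_iff:
  "x \<in> G2_cone \<longleftrightarrow> x \<in> G2_span \<and>
    (\<forall>i j k l. pluecker x i j * pluecker x k l - pluecker x i k * pluecker x j l + pluecker x i l * pluecker x j k = 0)"
    (is "_ \<longleftrightarrow> ?R")
proof
  assume "x \<in> G2_cone"
  then show ?R
    unfolding G2_cone_def G2_span_def by (auto simp: wedge_degree_one_bivector pluecker_wedge algebra_simps)
next
  assume R: ?R
  then obtain f g where "x = degree_one f \<and>\<^sub>\<Lambda> degree_one g"
    using decomposable_if_pluecker_relations[of x] unfolding G2_span_def by blast
  then show "x \<in> G2_cone" using R unfolding G2_cone_def G2_span_def by blast
qed

lemma subspace_G2_span: "vec.subspace G2_span"
  using subspace_bivectors unfolding G2_span_def G2_equations_def
  by (auto simp: vec.subspace_def pluecker_lin)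

lemma zariski_closed_hatG2: "zariski_closed (proj_space G2_cone)"
proof -
  define S where "S = (\<Union>A\<in>{A. card A \<noteq> 2}. {\<lambda>x :: 7 ext. x $ A})
    \<union> {\<lambda>x. pluecker x 1 2, \<lambda>x. pluecker x 4 5, \<lambda>x. pluecker x 2 5 + pluecker x 1 4,
       \<lambda>x. pluecker x 5 7 - pluecker x 1 3, \<lambda>x. pluecker x 5 6 + pluecker x 1 7,
       \<lambda>x. pluecker x 4 7 + pluecker x 2 3, \<lambda>x. pluecker x 4 6 - pluecker x 2 7}
    \<union> (\<Union>i j k l. {\<lambda>x. pluecker x i j * pluecker x k l - pluecker x i k * pluecker x j l + pluecker x i l * pluecker x j k})"
  have quadric: "form (1 + 1) (\<lambda>x. pluecker x i j * pluecker x k l - pluecker x i k * pluecker x j l + pluecker x i l * pluecker x j k)"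
    for i j k l :: 7
    by (intro form_add form_diff form_mult form_pluecker)
  have linear: "form 1 (\<lambda>x. pluecker x i j + pluecker x k l)" "form 1 (\<lambda>x. pluecker x i j - pluecker x k l)"
    for i j k l :: 7
    by (intro form_add form_diff form_pluecker)+
  have forms: "\<exists>d. form d f" if "f \<in> S" for f
    using that unfolding S_def
    by (elim UnE UN_E CollectE insertE emptyE; hypsubst; blast intro: form_coord form_pluecker quadric linear)
  have S: "(\<forall>f\<in>S. f x = 0) \<longleftrightarrow> x \<in> G2_cone" for x
    unfolding S_def ball_Un G2_cone_iff G2_span_def bivectors_def G2_equations_def
    by (auto simp: eq_neg_iff_add_eq_0)
  have "proj_space G2_cone = proj_zeros S"
  proof (intro set_eqI iffI)
    fix P assume "P \<in> proj_space G2_cone"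
    then show "P \<in> proj_zeros S" using S proj_zeros_iff[of S] forms by (elim proj_spaceE) simp
  next
    fix P assume P: "P \<in> proj_zeros S"
    then have "P \<in> PP" unfolding proj_zeros_def by simp
    then obtain v where "v \<noteq> 0" "P = vec.span {v}" by (rule proj_spaceE)
    then show "P \<in> proj_space G2_cone"
      using P S proj_zeros_iff[of S] forms unfolding proj_space_def by blast
  qed
  then show ?thesis using forms by (simp add: zariski_closed_proj_zeros)
qed

section \<open>The parametrization by quadrics\<close>

definition tuple7 :: "complex \<Rightarrow> complex \<Rightarrow> complex \<Rightarrow> complex \<Rightarrow> complex \<Rightarrow> complex \<Rightarrow> complex \<Rightarrow> 7 \<Rightarrow> complex" where
  "tuple7 a b c d e f g i =
    (if i = 1 then a else if i = 2 then b else if i = 3 then c else if i = 4 then d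
     else if i = 5 then e else if i = 6 then f else g)"

lemma tuple7_nth:
  "tuple7 a b c d e f g 1 = a" "tuple7 a b c d e f g 2 = b" "tuple7 a b c d e f g 3 = c"
  "tuple7 a b c d e f g 4 = d" "tuple7 a b c d e f g 5 = e" "tuple7 a b c d e f g 6 = f"
  "tuple7 a b c d e f g 7 = g"
  by (simp_all add: tuple7_def)

definition tuple6 :: "complex \<Rightarrow> complex \<Rightarrow> complex \<Rightarrow> complex \<Rightarrow> complex \<Rightarrow> complex \<Rightarrow> complex ^ 6" where
  "tuple6 a b c d e f =
    (\<chi> i. if i = 1 then a else if i = 2 then b else if i = 3 then c else if i = 4 then d
     else if i = 5 then e else f)"

lemma tuple6_nth:
  "tuple6 a b c d e f $ 1 = a" "tuple6 a b c d e f $ 2 = b" "tuple6 a b c d e f $ 3 = c"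
  "tuple6 a b c d e f $ 4 = d" "tuple6 a b c d e f $ 5 = e" "tuple6 a b c d e f $ 6 = f"
  by (simp_all add: tuple6_def)

text \<open>
  The variables \<open>y\<^sub>1, \<dots>, y\<^sub>6\<close> stand for \<open>p\<^sub>1\<^sub>5, p\<^sub>1\<^sub>3, p\<^sub>1\<^sub>4, p\<^sub>1\<^sub>6, p\<^sub>1\<^sub>7, p\<^sub>3\<^sub>5\<close>. For \<open>y\<^sub>1 = 1\<close> the two vectors
  are the basis of the plane that is normalized at the indices \<open>1\<close> and \<open>5\<close>; the zeros and the repeated
  entries are what the linear equations force.
\<close>
definition \<phi>\<^sub>0 :: "complex ^ 6 \<Rightarrow> 7 ext" where
  "\<phi>\<^sub>0 y = degree_one (tuple7 (y $ 1) (- y $ 3) (y $ 6) 0 0 (y $ 5) (- y $ 2)) \<and>\<^sub>\<Lambda>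
          degree_one (tuple7 0 0 (y $ 2) (y $ 3) (y $ 1) (y $ 4) (y $ 5))"

lemma \<phi>\<^sub>0_in_G2_cone: "\<phi>\<^sub>0 y \<in> G2_cone"
proof -
  have "G2_equations (\<phi>\<^sub>0 y)"
    unfolding \<phi>\<^sub>0_def G2_equations_def pluecker_wedge tuple7_nth by simp
  then show ?thesis unfolding G2_cone_def \<phi>\<^sub>0_def by blast
qed

lemma \<phi>\<^sub>0_bivector: "\<phi>\<^sub>0 y \<in> bivectors"
  unfolding \<phi>\<^sub>0_def by (rule wedge_degree_one_bivector)

lemma form_tuple7:
  assumes "form d a" "form d b" "form d c" "form d e" "form d f" "form d g" "form d h"
  shows "form d (\<lambda>y. tuple7 (a y) (b y) (c y) (e y) (f y) (g y) (h y) i)"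
proof -
  have "\<forall>i. form d (\<lambda>y. tuple7 (a y) (b y) (c y) (e y) (f y) (g y) (h y) i)"
    unfolding all_7 tuple7_nth using assms by blast
  then show ?thesis by blast
qed

lemma bivector_form:
  assumes "\<And>y. \<Phi> y \<in> bivectors" "\<And>i j. form d (\<lambda>y. pluecker (\<Phi> y) i j)"
  shows "form d (\<lambda>y. \<Phi> y $ S)"
proof (cases "card S = 2")
  case True
  then obtain i j where S: "S = {i, j}" "i \<noteq> j" by (auto simp: card_2_iff)
  show ?thesis
    unfolding S(1) bivector_nth[OF S(2)] using assms(2)[of i j] form_uminus[OF assms(2)[of i j]]
    by (cases "i < j") simp_all
next
  case False
  then show ?thesis using assms(1) by (simp add: bivectors_def form_zero)
qed

lemma form_\<phi>\<^sub>0: "form 2 (\<lambda>y. \<phi>\<^sub>0 y $ S)"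
proof (rule bivector_form)
  have "form (1 + 1) (\<lambda>y. pluecker (\<phi>\<^sub>0 y) i j)" for i j
    unfolding \<phi>\<^sub>0_def pluecker_wedge
    by (intro form_diff form_mult form_tuple7 form_coord form_uminus form_zero)
  then show "form 2 (\<lambda>y. pluecker (\<phi>\<^sub>0 y) i j)" for i j by (simp only: one_add_one)
qed (rule \<phi>\<^sub>0_bivector)

lemma G2_coneD: "x \<in> G2_cone \<Longrightarrow> x \<in> bivectors" "x \<in> G2_cone \<Longrightarrow> G2_equations x"
  by (auto simp: G2_cone_def wedge_degree_one_bivector)

lemma G2_coneE:
  assumes "x \<in> G2_cone"
  obtains f g where "x = degree_one f \<and>\<^sub>\<Lambda> degree_one g"
  using assms by (auto simp: G2_cone_def)

lemma proportionalE:
  fixes u v a b :: complex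
  assumes "u * b = v * a" "\<not> (a = 0 \<and> b = 0)"
  obtains c where "u = c * a" "v = c * b"
proof (cases "a = 0")
  case True
  then show thesis using assms that[of "v / b"] by simp
next
  case False
  then show thesis using assms that[of "u / a"] by (simp add: eq_divide_eq)
qed

definition \<pi>\<^sub>0 :: "7 ext \<Rightarrow> complex ^ 6" where
  "\<pi>\<^sub>0 x = tuple6 (pluecker x 1 5) (pluecker x 1 3) (pluecker x 1 4) (pluecker x 1 6) (pluecker x 1 7) (pluecker x 3 5)"

lemma pluecker_relation:
  assumes "x \<in> G2_cone"
  shows "pluecker x i j * pluecker x k l = pluecker x i k * pluecker x j l - pluecker x i l * pluecker x j k"
proof -
  obtain f g where x: "x = degree_one f \<and>\<^sub>\<Lambda> degree_one g" using assms by (rule G2_coneE)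
  show ?thesis unfolding x pluecker_wedge by (simp add: algebra_simps)
qed

text \<open>
  At \<open>y = \<pi>\<^sub>0 x\<close> the two vectors defining \<open>\<phi>\<^sub>0 y\<close> are, by the linear equations, column \<open>5\<close> and row \<open>1\<close> of the
  matrix of Pluecker coordinates; the claim is then the Pluecker relation for \<open>1, 5, i, j\<close>.
\<close>
lemma \<phi>\<^sub>0_\<pi>\<^sub>0:
  assumes x: "x \<in> G2_cone"
  shows "\<phi>\<^sub>0 (\<pi>\<^sub>0 x) = pluecker x 1 5 *s x"
proof -
  have eqs: "G2_equations x" and bi: "x \<in> bivectors" using G2_coneD[OF x] by blast+
  let ?y = "\<pi>\<^sub>0 x"
  have v: "tuple7 (?y $ 1) (- ?y $ 3) (?y $ 6) 0 0 (?y $ 5) (- ?y $ 2) = (\<lambda>k. pluecker x k 5)"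
    using eqs pluecker_swap[of x 6 5] pluecker_swap[of x 7 5] unfolding fun_eq_iff all_7 G2_equations_def \<pi>\<^sub>0_def
    by (simp add: tuple7_nth tuple6_nth pluecker_self)
  have w: "tuple7 0 0 (?y $ 2) (?y $ 3) (?y $ 1) (?y $ 4) (?y $ 5) = (\<lambda>k. pluecker x 1 k)"
    using eqs unfolding fun_eq_iff all_7 G2_equations_def \<pi>\<^sub>0_def
    by (simp add: tuple7_nth tuple6_nth pluecker_self)
  show ?thesis
  proof (rule bivector_eqI)
    show "pluecker x 1 5 *s x \<in> bivectors"
      using bi subspace_bivectors by (rule vec.subspace_scale[rotated])
    show "pluecker (\<phi>\<^sub>0 ?y) i j = pluecker (pluecker x 1 5 *s x) i j" for i j
      unfolding \<phi>\<^sub>0_def v w pluecker_wedge pluecker_lin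
      using pluecker_relation[OF x, of 1 5 i j] pluecker_swap[of x 5 i] pluecker_swap[of x 5 j]
      by (simp add: algebra_simps)
  qed (rule \<phi>\<^sub>0_bivector)
qed

text \<open>
  The hyperplane \<open>y\<^sub>1 = 0\<close> is mapped birationally to \<open>F4\<close>. The argument is that of \<open>\<phi>\<^sub>0_\<pi>\<^sub>0\<close>, with the rows
  \<open>4\<close> and \<open>2\<close> in place of column \<open>5\<close> and row \<open>1\<close>.
\<close>
lemma \<phi>\<^sub>0_F_point:
  assumes x: "x \<in> G2_cone" and F: "\<And>k. pluecker x 1 k = 0" "\<And>k. pluecker x 5 k = 0"
  shows "\<phi>\<^sub>0 (tuple6 0 (pluecker x 2 3) (pluecker x 2 4) (pluecker x 2 6) (pluecker x 2 7) (- pluecker x 3 4)) =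
    - pluecker x 2 4 *s x" (is "\<phi>\<^sub>0 ?y = _")
proof -
  have eqs: "G2_equations x" and bi: "x \<in> bivectors" using G2_coneD[OF x] by blast+
  have v: "tuple7 (?y $ 1) (- ?y $ 3) (?y $ 6) 0 0 (?y $ 5) (- ?y $ 2) = (\<lambda>k. pluecker x 4 k)"
    using eqs F(1)[of 4] pluecker_swap[of x 4 1] pluecker_swap[of x 4 2] pluecker_swap[of x 4 3] unfolding fun_eq_iff all_7 G2_equations_def
    by (simp add: tuple7_nth tuple6_nth pluecker_self)
  have w: "tuple7 0 0 (?y $ 2) (?y $ 3) (?y $ 1) (?y $ 4) (?y $ 5) = (\<lambda>k. pluecker x 2 k)"
    using eqs F(1)[of 2] F(1)[of 4] pluecker_swap[of x 2 1] unfolding fun_eq_iff all_7 G2_equations_def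
    by (simp add: tuple7_nth tuple6_nth pluecker_self)
  show ?thesis
  proof (rule bivector_eqI)
    show "- pluecker x 2 4 *s x \<in> bivectors"
      using bi subspace_bivectors by (rule vec.subspace_scale[rotated])
    show "pluecker (\<phi>\<^sub>0 ?y) i j = pluecker (- pluecker x 2 4 *s x) i j" for i j
      unfolding \<phi>\<^sub>0_def v w pluecker_wedge pluecker_lin
      using pluecker_relation[OF x, of 2 4 i j] by (simp add: algebra_simps)
  qed (rule \<phi>\<^sub>0_bivector)
qed

section \<open>The parametrization is dominant\<close>

definition \<phi>\<^sub>0_multiples where "\<phi>\<^sub>0_multiples = {k *s \<phi>\<^sub>0 y | k y. True}"

lemma multiple_in_closure:
  assumes "\<phi>\<^sub>0 y = k *s x" "k \<noteq> 0"
  shows "x \<in> closure \<phi>\<^sub>0_multiples"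
proof -
  have "x = inverse k *s \<phi>\<^sub>0 y" using assms by (simp add: vector_smult_assoc)
  then have "x \<in> \<phi>\<^sub>0_multiples" unfolding \<phi>\<^sub>0_multiples_def by blast
  then show ?thesis using closure_subset by blast
qed

text \<open>
  The hypothesis says that \<open>\<phi>\<^sub>0\<close> vanishes at \<open>y0\<close> and has the derivative \<open>x\<close> there in the direction \<open>y1\<close>; the
  difference quotients are multiples of values of \<open>\<phi>\<^sub>0\<close>.
\<close>
lemma first_order_limit:
  assumes "\<And>s. \<phi>\<^sub>0 (y0 + s *s y1) = s *s x + s\<^sup>2 *s \<phi>\<^sub>0 y1"
  shows "x \<in> closure \<phi>\<^sub>0_multiples"
proof -
  define s where "s n = complex_of_real (inverse (real (Suc n)))" for n
  have "x + s n *s \<phi>\<^sub>0 y1 \<in> \<phi>\<^sub>0_multiples" for n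
  proof -
    have "s n \<noteq> 0" by (simp add: s_def del: of_nat_Suc)
    then have "x + s n *s \<phi>\<^sub>0 y1 = inverse (s n) *s \<phi>\<^sub>0 (y0 + s n *s y1)"
      by (simp add: assms vec.scale_right_distrib vector_smult_assoc power2_eq_square)
    then show ?thesis unfolding \<phi>\<^sub>0_multiples_def by blast
  qed
  moreover have "(\<lambda>n. x + s n *s \<phi>\<^sub>0 y1) \<longlonglongrightarrow> x"
  proof (rule vec_tendstoI)
    fix i
    have "(\<lambda>n. complex_of_real (inverse (real (Suc n)))) \<longlonglongrightarrow> complex_of_real 0"
      by (intro tendsto_of_real LIMSEQ_inverse_real_of_nat)
    then have "s \<longlonglongrightarrow> 0" unfolding s_def by (simp only: of_real_0)
    then have "(\<lambda>n. x $ i + s n * \<phi>\<^sub>0 y1 $ i) \<longlonglongrightarrow> x $ i + 0 * \<phi>\<^sub>0 y1 $ i"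
      by (intro tendsto_intros)
    then show "(\<lambda>n. (x + s n *s \<phi>\<^sub>0 y1) $ i) \<longlonglongrightarrow> x $ i" by simp
  qed
  ultimately show ?thesis
    unfolding closure_sequential by (intro exI[of _ "\<lambda>n. x + s n *s \<phi>\<^sub>0 y1"]) blast
qed

lemma wedge_degree_one_eqI:
  assumes "\<And>i j. f i * g j - f j * g i = f' i * g' j - f' j * g' i"
  shows "degree_one f \<and>\<^sub>\<Lambda> degree_one g = degree_one f' \<and>\<^sub>\<Lambda> degree_one g'"
  by (intro bivector_eqI wedge_degree_one_bivector) (simp only: pluecker_wedge assms)

text \<open>
  The left-hand sides are the derivatives of the coordinates \<open>p\<^sub>3\<^sub>6, p\<^sub>3\<^sub>7, p\<^sub>6\<^sub>7\<close> of \<open>\<phi>\<^sub>0\<close> at the point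
  \<open>(0, a\<^sub>1 a\<^sub>5\<^sup>2, 0, - a\<^sub>1\<^sup>3, a\<^sub>1\<^sup>2 a\<^sub>5, - a\<^sub>5\<^sup>3)\<close> of the cubic, and the right-hand sides are the same coordinates of
  \<open>c \<and> (a\<^sub>5\<^sup>2, - a\<^sub>1\<^sup>2, a\<^sub>1 a\<^sub>5)\<close> at the indices \<open>3, 6, 7\<close>. The system has rank two: \<open>a\<^sub>3, b\<^sub>3\<close> alone solve it if \<open>a\<^sub>1 \<noteq> 0\<close>,
  and \<open>b\<^sub>6, b\<^sub>7\<close> alone if \<open>a\<^sub>5 \<noteq> 0\<close>.
\<close>
lemma conic_direction:
  fixes a1 a5 c3 c6 c7 :: complex
  assumes "a1 \<noteq> 0 \<or> a5 \<noteq> 0"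
  obtains a3 b3 b6 b7 :: complex where
    "- (a1^3) * a3 - a5^3 * b6 - a1 * a5^2 * b7 - a1^2 * a5 * b3 = - c3 * a1^2 - c6 * a5^2"
    "a1^2 * a5 * a3 - a5^3 * b7 + 2 * a1 * a5^2 * b3 = c3 * a1 * a5 - c7 * a5^2"
    "2 * a1^2 * a5 * b7 - a1^3 * b3 + a1 * a5^2 * b6 = c6 * a1 * a5 + c7 * a1^2"
proof (cases "a1 = 0")
  case False
  define a3 b3 where "a3 = (c3 * a1^2 + 2 * c6 * a5^2 + c7 * a1 * a5) / a1^3"
    and "b3 = - (c6 * a5 + c7 * a1) / a1^2"
  have a3: "a1^3 * a3 = c3 * a1^2 + 2 * c6 * a5^2 + c7 * a1 * a5"
    and b3: "a1^2 * b3 = - (c6 * a5 + c7 * a1)"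
    using False by (simp_all add: a3_def b3_def)
  show thesis
  proof (rule that[of a3 0 0 b3])
    have "a1 * (a1^2 * a5 * a3 - a5^3 * 0 + 2 * a1 * a5^2 * b3) = a1 * (c3 * a1 * a5 - c7 * a5^2)"
      using a3 b3 by algebra
    then show "a1^2 * a5 * a3 - a5^3 * 0 + 2 * a1 * a5^2 * b3 = c3 * a1 * a5 - c7 * a5^2"
      using False mult_left_cancel by blast
  qed (use a3 b3 in algebra)+
next
  case True
  with assms have a5: "a5 \<noteq> 0" by simp
  define b6 b7 where "b6 = c6 / a5" and "b7 = c7 / a5"
  have "c6 = a5 * b6" "c7 = a5 * b7"
    using a5 by (simp_all add: b6_def b7_def)
  then show thesis
    using True by (intro that[of 0 b6 b7 0]) (simp_all add: power2_eq_square power3_eq_cube)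
qed

lemma conic_point:
  assumes "z^2 = - x * (y :: complex)"
  obtains a1 a5 :: complex where "x = a5^2" "z = a1 * a5" "y = - (a1^2)"
proof (cases "x = 0")
  case True
  then show thesis using assms that[of 0 "csqrt (- y)"] by simp
next
  case False
  then have "csqrt x \<noteq> 0" by simp
  moreover have "x * y = x * (- ((z / csqrt x)^2))"
    using False assms by (simp add: power_divide)
  then have "y = - ((z / csqrt x)^2)" using False mult_left_cancel by blast
  ultimately show thesis using False that[of "csqrt x" "z / csqrt x"] by simp
qed

text \<open>
  Write \<open>g = (a\<^sub>5\<^sup>2, - a\<^sub>1\<^sup>2, a\<^sub>1 a\<^sub>5)\<close> at the indices \<open>3, 6, 7\<close>. If \<open>g \<noteq> 0\<close>, the linear equations force
  \<open>(f\<^sub>1, f\<^sub>5) = l (a\<^sub>1, a\<^sub>5)\<close> and \<open>(f\<^sub>2, f\<^sub>4) = m (a\<^sub>1, - a\<^sub>5)\<close>. The point of the cubic with parameters \<open>- a\<^sub>5, a\<^sub>1\<close> is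
  a base point of \<open>\<phi>\<^sub>0\<close>, at which the derivatives of \<open>\<phi>\<^sub>0\<close> are exactly the bivectors of this shape: \<open>l\<close> and
  \<open>- m\<close> are the first and third component of the direction, and the others account for \<open>f\<^sub>3, f\<^sub>6, f\<^sub>7\<close>.
\<close>
lemma exceptional_in_closure:
  assumes eqs: "G2_equations (degree_one f \<and>\<^sub>\<Lambda> degree_one g)"
    and g: "g 1 = 0" "g 5 = 0" "g 2 = 0" "g 4 = 0"
    and conic: "(g 7)^2 = - g 3 * g 6"
  shows "degree_one f \<and>\<^sub>\<Lambda> degree_one g \<in> closure \<phi>\<^sub>0_multiples"
proof -
  obtain a1 a5 :: complex where a: "g 3 = a5^2" "g 7 = a1 * a5" "g 6 = - (a1^2)"
    using conic_point[OF conic] .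
  show ?thesis
  proof (cases "a1 = 0 \<and> a5 = 0")
    case True
    then have "g i = 0" for i using g a all_7[of "\<lambda>i. g i = 0"] by simp
    then have "degree_one f \<and>\<^sub>\<Lambda> degree_one g = 0 *s \<phi>\<^sub>0 0"
      using wedge_degree_one_bivector vec.subspace_0[OF subspace_bivectors]
      by (intro bivector_eqI) (auto simp: pluecker_wedge pluecker_lin)
    then have "degree_one f \<and>\<^sub>\<Lambda> degree_one g \<in> \<phi>\<^sub>0_multiples" unfolding \<phi>\<^sub>0_multiples_def by blast
    then show ?thesis using closure_subset by blast
  next
    case False
    have "a5 * (f 5 * a1 - f 1 * a5) = 0" "a1 * (f 5 * a1 - f 1 * a5) = 0"
      using eqs g a unfolding G2_equations_def pluecker_wedge by (simp_all add: algebra_simps power2_eq_square)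
    then have "f 1 * a5 = f 5 * a1" using False by auto
    then obtain l where l: "f 1 = l * a1" "f 5 = l * a5"
      using proportionalE False by metis
    have "f 4 * (a1 * a5) = - (f 2 * a5^2)" "f 4 * - (a1^2) = f 2 * (a1 * a5)"
      using eqs g a unfolding G2_equations_def pluecker_wedge by simp_all
    then have "a5 * (f 4 * a1 + f 2 * a5) = 0" "a1 * (f 4 * a1 + f 2 * a5) = 0"
      by algebra+
    then have "f 4 * a1 + f 2 * a5 = 0" using False by auto
    then have "f 2 * a5 = (- f 4) * a1" by algebra
    then obtain m where m: "f 2 = m * a1" "- f 4 = m * a5"
      using proportionalE False by metis
    have m': "f 4 = - (m * a5)" using m(2) by (metis minus_minus)
    obtain a3 b3 b6 b7 :: complex where dir:
      "- (a1^3) * a3 - a5^3 * b6 - a1 * a5^2 * b7 - a1^2 * a5 * b3 = - f 3 * a1^2 - f 6 * a5^2"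
      "a1^2 * a5 * a3 - a5^3 * b7 + 2 * a1 * a5^2 * b3 = f 3 * a1 * a5 - f 7 * a5^2"
      "2 * a1^2 * a5 * b7 - a1^3 * b3 + a1 * a5^2 * b6 = f 6 * a1 * a5 + f 7 * a1^2"
      using False conic_direction by metis
    let ?y0 = "tuple6 0 (a1 * a5^2) 0 (- (a1^3)) (a1^2 * a5) (- (a5^3))"
    let ?y1 = "tuple6 l b3 (- m) b6 b7 a3"
    have "\<phi>\<^sub>0 (?y0 + s *s ?y1) = s *s (degree_one f \<and>\<^sub>\<Lambda> degree_one g) + s\<^sup>2 *s \<phi>\<^sub>0 ?y1" for s
    proof (rule bivector_eqI)
      show "s *s (degree_one f \<and>\<^sub>\<Lambda> degree_one g) + s\<^sup>2 *s \<phi>\<^sub>0 ?y1 \<in> bivectors"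
        by (intro vec.subspace_add vec.subspace_scale subspace_bivectors wedge_degree_one_bivector \<phi>\<^sub>0_bivector)
      have "\<forall>i j. pluecker (\<phi>\<^sub>0 (?y0 + s *s ?y1)) i j = pluecker (s *s (degree_one f \<and>\<^sub>\<Lambda> degree_one g) + s\<^sup>2 *s \<phi>\<^sub>0 ?y1) i j"
        unfolding all_7 \<phi>\<^sub>0_def pluecker_lin pluecker_wedge
          vector_add_component vector_smult_component tuple6_nth tuple7_nth g a l m(1) m'
        \<comment> \<open>Most of these identities hold in the polynomial ring; those for \<open>p\<^sub>3\<^sub>6, p\<^sub>3\<^sub>7, p\<^sub>6\<^sub>7\<close> use the choice of the direction.\<close>
        by (intro conjI; (algebra | use dir in algebra))
      then show "pluecker (\<phi>\<^sub>0 (?y0 + s *s ?y1)) i j = pluecker (s *s (degree_one f \<and>\<^sub>\<Lambda> degree_one g) + s\<^sup>2 *s \<phi>\<^sub>0 ?y1) i j" for i j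
        by blast
    qed (rule \<phi>\<^sub>0_bivector)
    then show ?thesis by (rule first_order_limit)
  qed
qed

text \<open>
  If the coordinates at \<open>a\<close> and \<open>b\<close> do not separate the two vectors, then some vector of the plane vanishes at
  both indices; it is completed to a basis without changing the bivector.
\<close>
lemma plane_basis_vanishing:
  fixes f g :: "'n::{finite,linorder} \<Rightarrow> complex"
  assumes "f a * g b = f b * g a"
  obtains f' g' where "degree_one f' \<and>\<^sub>\<Lambda> degree_one g' = degree_one f \<and>\<^sub>\<Lambda> degree_one g" "g' a = 0" "g' b = 0"
    "\<And>i. f i = 0 \<Longrightarrow> g i = 0 \<Longrightarrow> f' i = 0 \<and> g' i = 0"
proof (cases "f a = 0 \<and> f b = 0")
  case True
  have "degree_one g \<and>\<^sub>\<Lambda> degree_one (\<lambda>i. - f i) = degree_one f \<and>\<^sub>\<Lambda> degree_one g"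
    by (rule wedge_degree_one_eqI) (simp add: algebra_simps)
  then show thesis using True that[of g "\<lambda>i. - f i"] by simp
next
  case False
  moreover have "g a * f b = g b * f a" using assms by (simp add: mult.commute)
  ultimately obtain c where c: "g a = c * f a" "g b = c * f b"
    using proportionalE by metis
  have "degree_one f \<and>\<^sub>\<Lambda> degree_one (\<lambda>i. g i - c * f i) = degree_one f \<and>\<^sub>\<Lambda> degree_one g"
    by (rule wedge_degree_one_eqI) (simp add: algebra_simps)
  then show thesis using c that[of f "\<lambda>i. g i - c * f i"] by simp
qed

text \<open>
  A line in a projective plane meets a conic: the pencil \<open>g + r f\<close> leads to a quadratic equation for
  \<open>r\<close>, whose leading coefficient vanishes only if \<open>f\<close> is on the conic itself.
\<close>
lemma meets_conic:
  fixes f g :: "7 \<Rightarrow> complex"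
  obtains f' g' where "degree_one f' \<and>\<^sub>\<Lambda> degree_one g' = degree_one f \<and>\<^sub>\<Lambda> degree_one g" "(g' 7)^2 = - g' 3 * g' 6"
    "\<And>i. f i = 0 \<Longrightarrow> g i = 0 \<Longrightarrow> f' i = 0 \<and> g' i = 0"
proof (cases "(f 7)^2 + f 3 * f 6 = 0")
  case True
  have "degree_one g \<and>\<^sub>\<Lambda> degree_one (\<lambda>i. - f i) = degree_one f \<and>\<^sub>\<Lambda> degree_one g"
    by (rule wedge_degree_one_eqI) (simp add: algebra_simps)
  then show thesis using True that[of g "\<lambda>i. - f i"] by (simp add: add_eq_0_iff)
next
  case False
  define A B C where "A = (f 7)^2 + f 3 * f 6" and "B = 2 * f 7 * g 7 + f 3 * g 6 + g 3 * f 6"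
    and "C = (g 7)^2 + g 3 * g 6"
  define r where "r = (- B + csqrt (B^2 - 4 * A * C)) / (2 * A)"
  have A: "A \<noteq> 0" using False by (simp add: A_def)
  then have "2 * A * r + B = csqrt (B^2 - 4 * A * C)" by (simp add: r_def)
  then have "(2 * A * r + B)^2 = B^2 - 4 * A * C" by simp
  then have "4 * A * (A * r^2 + B * r + C) = 0" by algebra
  then have "A * r^2 + B * r + C = 0" using A by simp
  then have "(g 7 + r * f 7)^2 = - (g 3 + r * f 3) * (g 6 + r * f 6)"
    unfolding A_def B_def C_def by algebra
  moreover have "degree_one f \<and>\<^sub>\<Lambda> degree_one (\<lambda>i. g i + r * f i) = degree_one f \<and>\<^sub>\<Lambda> degree_one g"
    by (rule wedge_degree_one_eqI) (simp add: algebra_simps)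
  ultimately show thesis using that[of f "\<lambda>i. g i + r * f i"] by simp
qed

text \<open>
  Points with \<open>p\<^sub>1\<^sub>5 \<noteq> 0\<close> are multiples of values of \<open>\<phi>\<^sub>0\<close>, and so are points of \<open>F4\<close> with \<open>p\<^sub>2\<^sub>4 \<noteq> 0\<close>. In the other
  cases the plane contains a vector \<open>g\<close> in \<open>\<langle>x\<^sub>3, x\<^sub>6, x\<^sub>7\<rangle>\<close> on the exceptional conic. If the other
  basis vector has a nonzero entry at \<open>1, 5\<close> or at \<open>2, 4\<close>, the linear equations put \<open>g\<close> on the conic;
  otherwise the plane lies in \<open>\<langle>x\<^sub>3, x\<^sub>6, x\<^sub>7\<rangle>\<close> and meets the conic anyway.
\<close>
lemma G2_cone_subset_closure: "G2_cone \<subseteq> closure \<phi>\<^sub>0_multiples"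
proof
  fix x assume x: "x \<in> G2_cone"
  then obtain f g where x_fg: "x = degree_one f \<and>\<^sub>\<Lambda> degree_one g" by (rule G2_coneE)
  have eqs: "G2_equations x" using x by (rule G2_coneD)
  show "x \<in> closure \<phi>\<^sub>0_multiples"
  proof (cases "pluecker x 1 5 = 0")
    case False
    then show ?thesis using multiple_in_closure[OF \<phi>\<^sub>0_\<pi>\<^sub>0[OF x]] by blast
  next
    case True
    then have "f 1 * g 5 = f 5 * g 1" by (simp add: x_fg pluecker_wedge)
    then obtain f1 g1 where fg1: "degree_one f1 \<and>\<^sub>\<Lambda> degree_one g1 = x" "g1 1 = 0" "g1 5 = 0"
      using plane_basis_vanishing[of f 1 g 5] x_fg by metis
    have eqs1: "G2_equations (degree_one f1 \<and>\<^sub>\<Lambda> degree_one g1)" using eqs fg1 by simp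
    show ?thesis
    proof (cases "f1 1 = 0 \<and> f1 5 = 0")
      case False
      have "f1 1 * g1 2 = 0" "f1 5 * g1 4 = 0" "f1 5 * g1 2 = f1 1 * g1 4"
        using eqs1 fg1 unfolding G2_equations_def pluecker_wedge by simp_all
      then have "g1 2 = 0" "g1 4 = 0" using False by auto
      moreover have "f1 1 * g1 3 = f1 5 * g1 7" "f1 5 * g1 6 = - f1 1 * g1 7"
        using eqs1 fg1 unfolding G2_equations_def pluecker_wedge by simp_all
      then have "f1 1 * ((g1 7)^2 + g1 3 * g1 6) = 0" "f1 5 * ((g1 7)^2 + g1 3 * g1 6) = 0"
        by algebra+
      then have "(g1 7)^2 = - g1 3 * g1 6" using False by (auto simp: add_eq_0_iff)
      ultimately show ?thesis using exceptional_in_closure[OF eqs1] fg1 by simp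
    next
      case f1: True
      show ?thesis
      proof (cases "pluecker x 2 4 = 0")
        case False
        have "pluecker x 1 k = 0" "pluecker x 5 k = 0" for k
          using f1 fg1 by (simp_all add: pluecker_wedge flip: fg1(1))
        then show ?thesis using multiple_in_closure[OF \<phi>\<^sub>0_F_point[OF x]] False by simp
      next
        case True
        then have "f1 2 * g1 4 = f1 4 * g1 2" by (simp add: pluecker_wedge flip: fg1(1))
        then obtain f2 g2 where fg2: "degree_one f2 \<and>\<^sub>\<Lambda> degree_one g2 = x" "g2 2 = 0" "g2 4 = 0"
          "f2 1 = 0" "f2 5 = 0" "g2 1 = 0" "g2 5 = 0"
          using plane_basis_vanishing[of f1 2 g1 4] fg1 f1 by metis
        have eqs2: "G2_equations (degree_one f2 \<and>\<^sub>\<Lambda> degree_one g2)" using eqs fg2 by simp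
        show ?thesis
        proof (cases "f2 2 = 0 \<and> f2 4 = 0")
          case False
          have "f2 4 * g2 7 = - f2 2 * g2 3" "f2 4 * g2 6 = f2 2 * g2 7"
            using eqs2 fg2 unfolding G2_equations_def pluecker_wedge by simp_all
          then have "f2 2 * ((g2 7)^2 + g2 3 * g2 6) = 0" "f2 4 * ((g2 7)^2 + g2 3 * g2 6) = 0"
            by algebra+
          then have "(g2 7)^2 = - g2 3 * g2 6" using False by (auto simp: add_eq_0_iff)
          then show ?thesis using exceptional_in_closure[OF eqs2] fg2 by simp
        next
          case True
          obtain f3 g3 where fg3: "degree_one f3 \<and>\<^sub>\<Lambda> degree_one g3 = degree_one f2 \<and>\<^sub>\<Lambda> degree_one g2" "(g3 7)^2 = - g3 3 * g3 6"
            "\<And>i. f2 i = 0 \<Longrightarrow> g2 i = 0 \<Longrightarrow> f3 i = 0 \<and> g3 i = 0"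
            by (rule meets_conic[of f2 g2]) blast
          then show ?thesis using exceptional_in_closure[of f3 g3] eqs2 fg2 True by simp
        qed
      qed
    qed
  qed
qed

section \<open>Linear coordinates on the span of the variety\<close>

text \<open>
  Basis, dual coordinates and the coordinates of \<open>\<phi>\<^sub>0\<close> are listed in the same order: the first six
  positions are those read by the projection, and the last eight belong to \<open>F4\<close>.
\<close>
definition G2_basis :: "nat \<Rightarrow> 7 ext" where
  "G2_basis n =
    [bx 1 \<and>\<^sub>\<Lambda> bx 5, bx 1 \<and>\<^sub>\<Lambda> bx 3 + bx 5 \<and>\<^sub>\<Lambda> bx 7, bx 1 \<and>\<^sub>\<Lambda> bx 4 - bx 2 \<and>\<^sub>\<Lambda> bx 5,
     bx 1 \<and>\<^sub>\<Lambda> bx 6, bx 1 \<and>\<^sub>\<Lambda> bx 7 - bx 5 \<and>\<^sub>\<Lambda> bx 6, bx 3 \<and>\<^sub>\<Lambda> bx 5,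
     bx 4 \<and>\<^sub>\<Lambda> bx 7 - bx 2 \<and>\<^sub>\<Lambda> bx 3, bx 4 \<and>\<^sub>\<Lambda> bx 2, bx 6 \<and>\<^sub>\<Lambda> bx 2, bx 7 \<and>\<^sub>\<Lambda> bx 2 + bx 6 \<and>\<^sub>\<Lambda> bx 4,
     bx 3 \<and>\<^sub>\<Lambda> bx 4, bx 3 \<and>\<^sub>\<Lambda> bx 6, bx 3 \<and>\<^sub>\<Lambda> bx 7, bx 6 \<and>\<^sub>\<Lambda> bx 7] ! n"

definition G2_coord :: "nat \<Rightarrow> 7 ext \<Rightarrow> complex" where
  "G2_coord n x = [pluecker x 1 5, pluecker x 1 3, pluecker x 1 4, pluecker x 1 6, pluecker x 1 7, pluecker x 3 5,
     pluecker x 4 7, pluecker x 4 2, pluecker x 6 2, pluecker x 7 2, pluecker x 3 4, pluecker x 3 6,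
     pluecker x 3 7, pluecker x 6 7] ! n"

definition quadric :: "nat \<Rightarrow> complex ^ 6 \<Rightarrow> complex" where
  "quadric n y = [y $ 1 * y $ 1, y $ 1 * y $ 2, y $ 1 * y $ 3, y $ 1 * y $ 4, y $ 1 * y $ 5, y $ 1 * y $ 6,
     y $ 2 * y $ 3, y $ 3 * y $ 3, y $ 3 * y $ 4, y $ 3 * y $ 5, y $ 6 * y $ 3,
     y $ 6 * y $ 4 - y $ 2 * y $ 5, y $ 6 * y $ 5 + y $ 2 * y $ 2, y $ 5 * y $ 5 + y $ 2 * y $ 4] ! n"

lemma G2_basis_nth:
  "G2_basis 0 = bx 1 \<and>\<^sub>\<Lambda> bx 5"
  "G2_basis 1 = bx 1 \<and>\<^sub>\<Lambda> bx 3 + bx 5 \<and>\<^sub>\<Lambda> bx 7"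
  "G2_basis 2 = bx 1 \<and>\<^sub>\<Lambda> bx 4 - bx 2 \<and>\<^sub>\<Lambda> bx 5"
  "G2_basis 3 = bx 1 \<and>\<^sub>\<Lambda> bx 6"
  "G2_basis 4 = bx 1 \<and>\<^sub>\<Lambda> bx 7 - bx 5 \<and>\<^sub>\<Lambda> bx 6"
  "G2_basis 5 = bx 3 \<and>\<^sub>\<Lambda> bx 5"
  "G2_basis 6 = bx 4 \<and>\<^sub>\<Lambda> bx 7 - bx 2 \<and>\<^sub>\<Lambda> bx 3"
  "G2_basis 7 = bx 4 \<and>\<^sub>\<Lambda> bx 2"
  "G2_basis 8 = bx 6 \<and>\<^sub>\<Lambda> bx 2"
  "G2_basis 9 = bx 7 \<and>\<^sub>\<Lambda> bx 2 + bx 6 \<and>\<^sub>\<Lambda> bx 4"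
  "G2_basis 10 = bx 3 \<and>\<^sub>\<Lambda> bx 4"
  "G2_basis 11 = bx 3 \<and>\<^sub>\<Lambda> bx 6"
  "G2_basis 12 = bx 3 \<and>\<^sub>\<Lambda> bx 7"
  "G2_basis 13 = bx 6 \<and>\<^sub>\<Lambda> bx 7"
  by (simp_all add: G2_basis_def)

lemma G2_coord_nth:
  "G2_coord 0 x = pluecker x 1 5"
  "G2_coord 1 x = pluecker x 1 3"
  "G2_coord 2 x = pluecker x 1 4"
  "G2_coord 3 x = pluecker x 1 6"
  "G2_coord 4 x = pluecker x 1 7"
  "G2_coord 5 x = pluecker x 3 5"
  "G2_coord 6 x = pluecker x 4 7"
  "G2_coord 7 x = pluecker x 4 2"
  "G2_coord 8 x = pluecker x 6 2"
  "G2_coord 9 x = pluecker x 7 2"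
  "G2_coord 10 x = pluecker x 3 4"
  "G2_coord 11 x = pluecker x 3 6"
  "G2_coord 12 x = pluecker x 3 7"
  "G2_coord 13 x = pluecker x 6 7"
  by (simp_all add: G2_coord_def)

lemma quadric_nth:
  "quadric 0 y = y $ 1 * y $ 1"
  "quadric 1 y = y $ 1 * y $ 2"
  "quadric 2 y = y $ 1 * y $ 3"
  "quadric 3 y = y $ 1 * y $ 4"
  "quadric 4 y = y $ 1 * y $ 5"
  "quadric 5 y = y $ 1 * y $ 6"
  "quadric 6 y = y $ 2 * y $ 3"
  "quadric 7 y = y $ 3 * y $ 3"
  "quadric 8 y = y $ 3 * y $ 4"
  "quadric 9 y = y $ 3 * y $ 5"
  "quadric 10 y = y $ 6 * y $ 3"
  "quadric 11 y = y $ 6 * y $ 4 - y $ 2 * y $ 5"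
  "quadric 12 y = y $ 6 * y $ 5 + y $ 2 * y $ 2"
  "quadric 13 y = y $ 5 * y $ 5 + y $ 2 * y $ 4"
  by (simp_all add: quadric_def)

lemma pluecker_basis_wedge: "pluecker (ext_basis i \<and>\<^sub>\<Lambda> ext_basis j) k l = (if k = i \<and> l = j then 1 else 0) - (if l = i \<and> k = j then 1 else 0)"
  unfolding degree_one_basis pluecker_wedge
  by (cases "k = i"; cases "l = j"; cases "l = i"; cases "k = j"; simp)

lemma basis_wedge_bivector: "ext_basis i \<and>\<^sub>\<Lambda> ext_basis j \<in> bivectors"
  unfolding degree_one_basis by (rule wedge_degree_one_bivector)

lemma sum_14: "(\<Sum>n<14. f n) = f 0 + f 1 + f 2 + f 3 + f 4 + f 5 + f 6 + f 7 + f 8 + f 9 + f 10 + f 11 + f 12 + f 13"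
  for f :: "nat \<Rightarrow> 'a::comm_monoid_add"
  by (simp add: lessThan_nat_numeral lessThan_Suc ac_simps)

lemma all_less_14: "(\<forall>n<14. P n) \<longleftrightarrow>
    P 0 \<and> P 1 \<and> P 2 \<and> P 3 \<and> P 4 \<and> P 5 \<and> P 6 \<and> P 7 \<and> P 8 \<and> P 9 \<and> P 10 \<and> P 11 \<and> P 12 \<and> P (13::nat)"
proof -
  have "(\<forall>n<14. P n) \<longleftrightarrow> (\<forall>n\<in>{..<14}. P n)" by auto
  then show ?thesis by (simp add: lessThan_nat_numeral lessThan_Suc) blast
qed

lemma all_less_6: "(\<forall>n<6. P n) \<longleftrightarrow> P 0 \<and> P 1 \<and> P 2 \<and> P 3 \<and> P 4 \<and> P (5::nat)"
proof -
  have "(\<forall>n<6. P n) \<longleftrightarrow> (\<forall>n\<in>{..<6}. P n)" by auto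
  then show ?thesis by (simp add: lessThan_nat_numeral lessThan_Suc) blast
qed

lemma G2_basis_span: "n < 14 \<Longrightarrow> G2_basis n \<in> G2_span"
proof -
  have "\<forall>n<14. G2_basis n \<in> bivectors"
    unfolding all_less_14 G2_basis_nth
    by (simp add: basis_wedge_bivector vec.subspace_add[OF subspace_bivectors] vec.subspace_diff[OF subspace_bivectors])
  moreover have "\<forall>n<14. G2_equations (G2_basis n)"
    unfolding all_less_14 G2_basis_nth G2_equations_def
    by (simp add: pluecker_lin pluecker_basis_wedge)
  ultimately show "n < 14 \<Longrightarrow> G2_basis n \<in> G2_span" unfolding G2_span_def by simp
qed

lemma G2_coord_basis:
  assumes "m < 14" "n < 14"
  shows "G2_coord m (G2_basis n) = (if m = n then 1 else 0)"
proof -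
  have "\<forall>m<14. \<forall>n<14. G2_coord m (G2_basis n) = (if m = n then 1 else 0)"
    unfolding all_less_14 G2_basis_nth G2_coord_nth
    by (simp add: pluecker_lin pluecker_basis_wedge)
  then show ?thesis using assms by blast
qed

lemma G2_coord_lin:
  assumes "n < 14"
  shows "G2_coord n (x + y) = G2_coord n x + G2_coord n y" "G2_coord n (c *s x) = c * G2_coord n x"
    "G2_coord n 0 = 0" "G2_coord n (x - y) = G2_coord n x - G2_coord n y"
proof -
  have "\<forall>n<14. G2_coord n (x + y) = G2_coord n x + G2_coord n y \<and> G2_coord n (c *s x) = c * G2_coord n x
      \<and> G2_coord n 0 = 0 \<and> G2_coord n (x - y) = G2_coord n x - G2_coord n y"
    unfolding all_less_14 G2_coord_nth by (simp add: pluecker_lin)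
  then show "G2_coord n (x + y) = G2_coord n x + G2_coord n y" "G2_coord n (c *s x) = c * G2_coord n x"
    "G2_coord n 0 = 0" "G2_coord n (x - y) = G2_coord n x - G2_coord n y"
    using assms by blast+
qed

lemma G2_coord_sum:
  assumes "n < 14"
  shows "G2_coord n (\<Sum>i\<in>I. c i *s x i) = (\<Sum>i\<in>I. c i * G2_coord n (x i))"
  by (induction I rule: infinite_finite_induct) (simp_all add: G2_coord_lin[OF assms])

text \<open>
  The equations recover the seven Pluecker coordinates that are not listed.
\<close>
lemma G2_span_eqI:
  assumes "x \<in> G2_span" "y \<in> G2_span" "\<And>n. n < 14 \<Longrightarrow> G2_coord n x = G2_coord n y"
  shows "x = y"
proof -
  let ?E = "\<lambda>i j. pluecker x i j = pluecker y i j"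
  have "\<forall>n<14. G2_coord n x = G2_coord n y" using assms(3) by blast
  then have c: "?E 1 5" "?E 1 3" "?E 1 4" "?E 1 6" "?E 1 7" "?E 3 5" "?E 4 7" "?E 4 2" "?E 6 2" "?E 7 2"
      "?E 3 4" "?E 3 6" "?E 3 7" "?E 6 7"
    unfolding all_less_14 G2_coord_nth by blast+
  have swap: "?E j i" if "?E i j" for i j
    using that by (metis pluecker_swap)
  have l: "?E 1 2" "?E 4 5" "?E 2 5" "?E 5 7" "?E 5 6"
    using assms(1,2) c unfolding G2_span_def G2_equations_def by simp_all
  have "pluecker x 2 3 = - pluecker x 4 7" "pluecker y 2 3 = - pluecker y 4 7"
    "pluecker x 4 6 = - pluecker x 7 2" "pluecker y 4 6 = - pluecker y 7 2"
    using assms(1,2) pluecker_swap[of x 2 7] pluecker_swap[of y 2 7]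
    unfolding G2_span_def G2_equations_def by simp_all
  then have m: "?E 2 3" "?E 4 6" using c by simp_all
  have "\<forall>i j. ?E i j"
    unfolding all_7 by (intro conjI pluecker_self[THEN trans, OF pluecker_self[symmetric]] c l m swap[OF c(1)]
      swap[OF c(2)] swap[OF c(3)] swap[OF c(4)] swap[OF c(5)] swap[OF c(6)] swap[OF c(7)] swap[OF c(8)] swap[OF c(9)]
      swap[OF c(10)] swap[OF c(11)] swap[OF c(12)] swap[OF c(13)] swap[OF c(14)]
      swap[OF l(1)] swap[OF l(2)] swap[OF l(3)] swap[OF l(4)] swap[OF l(5)] swap[OF m(1)] swap[OF m(2)])
  then show ?thesis using assms(1,2) bivector_eqI unfolding G2_span_def by blast
qed

lemma G2_span_expand:
  assumes "x \<in> G2_span"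
  shows "x = (\<Sum>n<14. G2_coord n x *s G2_basis n)"
proof (rule G2_span_eqI[OF assms])
  show "(\<Sum>n<14. G2_coord n x *s G2_basis n) \<in> G2_span"
    by (intro vec.subspace_sum vec.subspace_scale subspace_G2_span G2_basis_span) simp
  fix m :: nat assume m: "m < 14"
  have "(\<Sum>n<14. G2_coord n x * G2_coord m (G2_basis n)) = (\<Sum>n<14. if m = n then G2_coord n x else 0)"
    by (intro sum.cong) (simp_all add: G2_coord_basis m)
  then show "G2_coord m x = G2_coord m (\<Sum>n<14. G2_coord n x *s G2_basis n)"
    using m by (simp add: G2_coord_sum)
qed

lemma independent_if_dual:
  fixes w :: "'i \<Rightarrow> complex ^ 'n"
  assumes I: "finite I"
    and dual: "\<And>i j. i \<in> I \<Longrightarrow> j \<in> I \<Longrightarrow> t i (w j) = (if i = j then 1 else 0)"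
    and lin: "\<And>i c. i \<in> I \<Longrightarrow> t i (\<Sum>j\<in>I. c j *s w j) = (\<Sum>j\<in>I. c j * t i (w j))"
  shows "inj_on w I" "vec.independent (w ` I)"
proof -
  show inj: "inj_on w I"
    by (rule inj_onI) (metis dual zero_neq_one)
  show "vec.independent (w ` I)"
  proof (rule vec.independent_if_scalars_zero)
    fix f x assume 0: "(\<Sum>x\<in>w ` I. f x *s x) = 0" and "x \<in> w ` I"
    then obtain i where i: "i \<in> I" "x = w i" by blast
    have s: "t i (\<Sum>j\<in>I. c j *s w j) = c i" for c
      using lin[OF i(1)] dual[OF i(1)] I i(1) by (simp add: if_distrib[of "(*) _"] cong: if_cong)
    have "(\<Sum>j\<in>I. f (w j) *s w j) = (\<Sum>j\<in>I. 0 *s w j)"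
      using 0 by (simp add: sum.reindex[OF inj])
    then show "f x = 0" using s[of "\<lambda>j. f (w j)"] s[of "\<lambda>_. 0"] i by simp
  qed (use I in simp)
qed

lemma G2_basis_independent:
  assumes "I \<subseteq> {..<14}"
  shows "inj_on G2_basis I" "vec.independent (G2_basis ` I)"
  by (rule independent_if_dual[where t = G2_coord and w = G2_basis and I = I];
      use assms finite_subset[OF assms] in \<open>auto simp: G2_coord_basis G2_coord_sum subset_iff\<close>)+

lemma G2_coord_\<phi>\<^sub>0: "n < 14 \<Longrightarrow> G2_coord n (\<phi>\<^sub>0 y) = quadric n y"
proof -
  have "\<forall>n<14. G2_coord n (\<phi>\<^sub>0 y) = quadric n y"
    unfolding all_less_14 G2_coord_nth quadric_nth \<phi>\<^sub>0_def
    by (simp add: pluecker_wedge tuple7_nth)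
  then show "n < 14 \<Longrightarrow> G2_coord n (\<phi>\<^sub>0 y) = quadric n y" by blast
qed

lemma \<phi>\<^sub>0_expand: "\<phi>\<^sub>0 y = (\<Sum>n<14. quadric n y *s G2_basis n)"
  using G2_span_expand[of "\<phi>\<^sub>0 y"] \<phi>\<^sub>0_in_G2_cone[of y] by (simp add: G2_coord_\<phi>\<^sub>0 G2_cone_iff)

text \<open>
  Up to previously obtained basis vectors, the values at sums of two unit vectors isolate the mixed
  monomials, so that all basis vectors are linear combinations of values of \<open>\<phi>\<^sub>0\<close>; those of \<open>F4\<close> need only
  points with \<open>y\<^sub>1 = 0\<close>.
\<close>
lemma \<phi>\<^sub>0_values:
  "\<phi>\<^sub>0 (tuple6 1 0 0 0 0 0) = G2_basis 0"
  "\<phi>\<^sub>0 (tuple6 1 1 0 0 0 0) = G2_basis 0 + G2_basis 1 + G2_basis 12"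
  "\<phi>\<^sub>0 (tuple6 1 0 1 0 0 0) = G2_basis 0 + G2_basis 2 + G2_basis 7"
  "\<phi>\<^sub>0 (tuple6 1 0 0 1 0 0) = G2_basis 0 + G2_basis 3"
  "\<phi>\<^sub>0 (tuple6 1 0 0 0 1 0) = G2_basis 0 + G2_basis 4 + G2_basis 13"
  "\<phi>\<^sub>0 (tuple6 1 0 0 0 0 1) = G2_basis 0 + G2_basis 5"
  "\<phi>\<^sub>0 (tuple6 0 1 1 0 0 0) = G2_basis 6 + G2_basis 7 + G2_basis 12"
  "\<phi>\<^sub>0 (tuple6 0 0 1 0 0 0) = G2_basis 7"
  "\<phi>\<^sub>0 (tuple6 0 0 1 1 0 0) = G2_basis 7 + G2_basis 8"
  "\<phi>\<^sub>0 (tuple6 0 0 1 0 1 0) = G2_basis 7 + G2_basis 9 + G2_basis 13"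
  "\<phi>\<^sub>0 (tuple6 0 0 1 0 0 1) = G2_basis 7 + G2_basis 10"
  "\<phi>\<^sub>0 (tuple6 0 0 0 1 0 1) = G2_basis 11"
  "\<phi>\<^sub>0 (tuple6 0 1 0 0 0 0) = G2_basis 12"
  "\<phi>\<^sub>0 (tuple6 0 0 0 0 1 0) = G2_basis 13"
  unfolding \<phi>\<^sub>0_expand sum_14 quadric_nth by (simp_all add: tuple6_nth)

lemma F_basis_in_subspace:
  assumes S: "vec.subspace S" and \<phi>: "\<And>y. y $ 1 = 0 \<Longrightarrow> \<phi>\<^sub>0 y \<in> S"
  shows "6 \<le> n \<Longrightarrow> n < 14 \<Longrightarrow> G2_basis n \<in> S"
proof -
  have cancel: "b \<in> S" if "a + b \<in> S" "a \<in> S" for a b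
    using vec.subspace_diff[OF S that] by simp
  have s: "G2_basis 7 \<in> S" "G2_basis 11 \<in> S" "G2_basis 12 \<in> S" "G2_basis 13 \<in> S"
    using \<phi> tuple6_nth(1) by (metis \<phi>\<^sub>0_values)+
  have "G2_basis 7 + G2_basis 8 \<in> S" "G2_basis 7 + G2_basis 10 \<in> S"
    "G2_basis 6 + G2_basis 7 + G2_basis 12 \<in> S" "G2_basis 7 + G2_basis 9 + G2_basis 13 \<in> S"
    using \<phi> tuple6_nth(1) by (metis \<phi>\<^sub>0_values)+
  then have "G2_basis 8 \<in> S" "G2_basis 10 \<in> S" "G2_basis 6 \<in> S" "G2_basis 9 \<in> S"
    using cancel s by (metis add.commute)+
  then have "\<forall>n<14. 6 \<le> n \<longrightarrow> G2_basis n \<in> S"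
    using s unfolding all_less_14 by simp
  then show "6 \<le> n \<Longrightarrow> n < 14 \<Longrightarrow> G2_basis n \<in> S" by blast
qed

text \<open>
  Stated for arbitrary subspaces, so that it serves both for linear spans and for kernels of linear
  functionals.
\<close>
lemma G2_basis_in_subspace:
  assumes S: "vec.subspace S" and \<phi>: "\<And>y. \<phi>\<^sub>0 y \<in> S"
  shows "n < 14 \<Longrightarrow> G2_basis n \<in> S"
proof -
  have cancel: "b \<in> S" if "a + b \<in> S" "a \<in> S" for a b
    using vec.subspace_diff[OF S that] by simp
  have F: "6 \<le> n \<Longrightarrow> n < 14 \<Longrightarrow> G2_basis n \<in> S" for n
    using F_basis_in_subspace[OF S] \<phi> by blast
  have s: "G2_basis 0 \<in> S" "G2_basis 12 \<in> S" "G2_basis 7 \<in> S" "G2_basis 13 \<in> S"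
    using \<phi> F by (metis \<phi>\<^sub>0_values)+
  have "G2_basis 0 + G2_basis 3 \<in> S" "G2_basis 0 + G2_basis 5 \<in> S"
    "G2_basis 0 + G2_basis 1 + G2_basis 12 \<in> S" "G2_basis 0 + G2_basis 2 + G2_basis 7 \<in> S"
    "G2_basis 0 + G2_basis 4 + G2_basis 13 \<in> S"
    using \<phi> by (metis \<phi>\<^sub>0_values)+
  then have "G2_basis 3 \<in> S" "G2_basis 5 \<in> S" "G2_basis 1 \<in> S" "G2_basis 2 \<in> S" "G2_basis 4 \<in> S"
    using cancel s by (metis add.commute)+
  then have "\<forall>n<14. G2_basis n \<in> S"
    using s F unfolding all_less_14 by simp
  then show "n < 14 \<Longrightarrow> G2_basis n \<in> S" by blast
qed

section \<open>The linear spans of the variety and of the fourfold\<close>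

lemma subspace_lin_span: "vec.subspace (lin_span X)"
  unfolding lin_span_def by (rule vec.subspace_span)

lemma lin_span_in: "vec.span {v} \<in> X \<Longrightarrow> v \<in> lin_span X"
  unfolding lin_span_def by (rule vec.span_base) (auto intro: vec.span_base)

lemma \<phi>\<^sub>0_in_lin_span_hatG2: "\<phi>\<^sub>0 y \<in> lin_span hatG2"
proof (cases "\<phi>\<^sub>0 y = 0")
  case True
  then show ?thesis by (simp add: vec.subspace_0 subspace_lin_span)
next
  case False
  then have "vec.span {\<phi>\<^sub>0 y} \<in> hatG2"
    unfolding hatG2_eq proj_space_def using \<phi>\<^sub>0_in_G2_cone by blast
  then show ?thesis by (rule lin_span_in)
qed

lemma \<phi>\<^sub>0_in_lin_span_F4:
  assumes "y $ 1 = 0"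
  shows "\<phi>\<^sub>0 y \<in> lin_span F4"
proof (cases "\<phi>\<^sub>0 y = 0")
  case True
  then show ?thesis by (simp add: vec.subspace_0 subspace_lin_span)
next
  case False
  let ?M = "vec.span {bx 2, bx 3, bx 4, bx 6, bx 7}"
  have M: "degree_one f \<in> ?M" if "f 1 = 0" "f 5 = 0" for f
  proof -
    have "\<forall>i. i \<notin> {2, 3, 4, 6, 7} \<longrightarrow> f i = 0" using that by (simp add: all_7)
    then show ?thesis using span_ext_basis[of "{2, 3, 4, 6, 7}"] by auto
  qed
  obtain f g where fg: "\<phi>\<^sub>0 y = degree_one f \<and>\<^sub>\<Lambda> degree_one g" "f 1 = 0" "f 5 = 0" "g 1 = 0" "g 5 = 0"
    by (rule that, rule \<phi>\<^sub>0_def) (simp_all add: tuple7_nth assms)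
  have "vec.span {\<phi>\<^sub>0 y} \<in> grassmannian2 ?M"
    unfolding grassmannian2_def
  proof (intro CollectI exI conjI)
    show "vec.span {\<phi>\<^sub>0 y} = vec.span {degree_one f \<and>\<^sub>\<Lambda> degree_one g}" by (simp only: fg)
    show "degree_one f \<in> ?M" by (rule M[OF fg(2,3)])
    show "degree_one g \<in> ?M" by (rule M[OF fg(4,5)])
    show "degree_one f \<and>\<^sub>\<Lambda> degree_one g \<noteq> 0" using False fg(1) by simp
  qed
  moreover have "vec.span {\<phi>\<^sub>0 y} \<in> hatG2"
    unfolding hatG2_eq proj_space_def using False \<phi>\<^sub>0_in_G2_cone by blast
  ultimately show ?thesis unfolding F4_def by (intro lin_span_in) simp
qed

lemma lin_span_hatG2: "lin_span hatG2 = G2_span"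
proof (rule subset_antisym)
  have "\<Union>hatG2 \<subseteq> G2_span"
    unfolding hatG2_eq using vec.span_minimal[OF _ subspace_G2_span] G2_cone_iff
    by (auto elim!: proj_spaceE) (metis empty_subsetI insert_subset subsetD)
  then show "lin_span hatG2 \<subseteq> G2_span"
    unfolding lin_span_def using subspace_G2_span by (rule vec.span_minimal)
  show "G2_span \<subseteq> lin_span hatG2"
  proof
    fix x assume "x \<in> G2_span"
    then have "x = (\<Sum>n<14. G2_coord n x *s G2_basis n)" by (rule G2_span_expand)
    moreover have "\<dots> \<in> lin_span hatG2"
      using G2_basis_in_subspace[OF subspace_lin_span \<phi>\<^sub>0_in_lin_span_hatG2]
      by (intro vec.subspace_sum vec.subspace_scale subspace_lin_span) simp
    ultimately show "x \<in> lin_span hatG2" by simp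
  qed
qed

definition F_span :: "7 ext set" where
  "F_span = {x \<in> G2_span. \<forall>n<6. G2_coord n x = 0}"

lemma subspace_F_span: "vec.subspace F_span"
  using subspace_G2_span unfolding F_span_def
  by (auto simp: vec.subspace_def G2_coord_lin)

lemma F_span_expand:
  assumes "x \<in> F_span"
  shows "x = (\<Sum>n\<in>{6..<14}. G2_coord n x *s G2_basis n)"
proof -
  have "x = (\<Sum>n<14. G2_coord n x *s G2_basis n)"
    using assms unfolding F_span_def by (intro G2_span_expand) simp
  also have "\<dots> = (\<Sum>n\<in>{6..<14}. G2_coord n x *s G2_basis n)"
    by (rule sum.mono_neutral_right) (use assms in \<open>auto simp: F_span_def\<close>)
  finally show ?thesis .
qed

lemma lin_span_F4: "lin_span F4 = F_span"
proof (rule subset_antisym)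
  have "P \<subseteq> F_span" if P: "P \<in> F4" for P
  proof -
    obtain v w where vw: "v \<in> vec.span {bx 2, bx 3, bx 4, bx 6, bx 7}" "w \<in> vec.span {bx 2, bx 3, bx 4, bx 6, bx 7}"
      and P_vw: "P = vec.span {v \<and>\<^sub>\<Lambda> w}"
      using P unfolding F4_def grassmannian2_def by blast
    obtain f where f: "v = degree_one f" "\<forall>i. i \<notin> {2, 3, 4, 6, 7} \<longrightarrow> f i = 0"
      using vw(1) span_ext_basis[of "{2, 3, 4, 6, 7}"] by auto
    obtain g where g: "w = degree_one g" "\<forall>i. i \<notin> {2, 3, 4, 6, 7} \<longrightarrow> g i = 0"
      using vw(2) span_ext_basis[of "{2, 3, 4, 6, 7}"] by auto
    have 0: "f 1 = 0" "f 5 = 0" "g 1 = 0" "g 5 = 0" using f(2) g(2) by simp_all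
    have "\<forall>n<6. G2_coord n (v \<and>\<^sub>\<Lambda> w) = 0"
      unfolding all_less_6 G2_coord_nth f g by (simp add: pluecker_wedge 0)
    moreover have "v \<and>\<^sub>\<Lambda> w \<in> G2_span"
      using P lin_span_in[of "v \<and>\<^sub>\<Lambda> w" hatG2] unfolding P_vw F4_def lin_span_hatG2 by simp
    ultimately have "v \<and>\<^sub>\<Lambda> w \<in> F_span" unfolding F_span_def by blast
    then show ?thesis unfolding P_vw by (intro vec.span_minimal subspace_F_span) simp
  qed
  then show "lin_span F4 \<subseteq> F_span"
    unfolding lin_span_def by (intro vec.span_minimal subspace_F_span) blast
  show "F_span \<subseteq> lin_span F4"
  proof
    fix x assume "x \<in> F_span"
    then have "x = (\<Sum>n\<in>{6..<14}. G2_coord n x *s G2_basis n)" by (rule F_span_expand)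
    moreover have "\<dots> \<in> lin_span F4"
      using F_basis_in_subspace[OF subspace_lin_span \<phi>\<^sub>0_in_lin_span_F4]
      by (intro vec.subspace_sum vec.subspace_scale subspace_lin_span) simp
    ultimately show "x \<in> lin_span F4" by simp
  qed
qed

lemma G2_basis_spans: "vec.span (G2_basis ` {..<14}) = G2_span"
proof (rule subset_antisym)
  show "vec.span (G2_basis ` {..<14}) \<subseteq> G2_span"
    using G2_basis_span by (intro vec.span_minimal subspace_G2_span) auto
  show "G2_span \<subseteq> vec.span (G2_basis ` {..<14})"
  proof
    fix x assume "x \<in> G2_span"
    then have "x = (\<Sum>n<14. G2_coord n x *s G2_basis n)" by (rule G2_span_expand)
    moreover have "\<dots> \<in> vec.span (G2_basis ` {..<14})"
      by (intro vec.span_sum vec.span_scale vec.span_base) simp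
    ultimately show "x \<in> vec.span (G2_basis ` {..<14})" by simp
  qed
qed

lemma F_basis_spans: "vec.span (G2_basis ` {6..<14}) = F_span"
proof (rule subset_antisym)
  have "G2_basis n \<in> F_span" if "n \<in> {6..<14}" for n
    using that G2_basis_span unfolding F_span_def by (auto simp: G2_coord_basis)
  then show "vec.span (G2_basis ` {6..<14}) \<subseteq> F_span"
    by (intro vec.span_minimal subspace_F_span) auto
  show "F_span \<subseteq> vec.span (G2_basis ` {6..<14})"
  proof
    fix x assume "x \<in> F_span"
    then have "x = (\<Sum>n\<in>{6..<14}. G2_coord n x *s G2_basis n)" by (rule F_span_expand)
    moreover have "\<dots> \<in> vec.span (G2_basis ` {6..<14})"
      by (intro vec.span_sum vec.span_scale vec.span_base) simp
    ultimately show "x \<in> vec.span (G2_basis ` {6..<14})" by simp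
  qed
qed

lemma dim_lin_span_hatG2: "vec.dim (lin_span hatG2) = 14"
  using vec.dim_span_eq_card_independent[OF G2_basis_independent(2)] card_image[OF G2_basis_independent(1)]
  unfolding lin_span_hatG2 G2_basis_spans[symmetric] by simp

lemma dim_lin_span_F4: "vec.dim (lin_span F4) = 8"
  using vec.dim_span_eq_card_independent[OF G2_basis_independent(2)] card_image[OF G2_basis_independent(1)]
  unfolding lin_span_F4 F_basis_spans[symmetric] by (simp add: subset_iff)

section \<open>Quadrics through the twisted cubic\<close>

lemma UNIV_6: "(UNIV :: 6 set) = {1, 2, 3, 4, 5, 6}"
proof -
  have "card {1, 2, 3, 4, 5, 6 :: 6} = CARD(6)" by simp
  then show ?thesis by (metis card_eq_UNIV_imp_eq_UNIV finite)
qed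

lemma all_6: "(\<forall>i :: 6. P i) \<longleftrightarrow> P 1 \<and> P 2 \<and> P 3 \<and> P 4 \<and> P 5 \<and> P 6"
proof -
  have "(\<forall>i. P i) \<longleftrightarrow> (\<forall>i\<in>UNIV. P i)" by simp
  then show ?thesis unfolding UNIV_6 by simp
qed

lemma sum_UNIV_6: "(\<Sum>i\<in>(UNIV :: 6 set). f i) = f 1 + f 2 + f 3 + f 4 + f 5 + f 6"
  for f :: "6 \<Rightarrow> 'a::comm_monoid_add"
  unfolding UNIV_6 by (simp add: ac_simps)

lemma form_2E:
  fixes g :: "complex ^ 'n \<Rightarrow> complex"
  assumes "form 2 g"
  obtains b where "\<And>y. g y = (\<Sum>i\<in>UNIV. \<Sum>j\<in>UNIV. b i j * (y $ i * y $ j))"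
proof -
  have "form (Suc 1) g" using assms by (simp only: Suc_1)
  then obtain h where h: "\<And>i. form 1 (h i)" "\<And>y. g y = (\<Sum>i\<in>UNIV. y $ i * h i y)"
    using form_Suc_decompose by blast
  have "\<exists>c. \<forall>y. h i y = (\<Sum>j\<in>UNIV. y $ j * c j)" for i
  proof -
    have "form (Suc 0) (h i)" using h(1) by (simp only: One_nat_def)
    then obtain k where k: "\<And>j. form 0 (k j)" "\<And>y. h i y = (\<Sum>j\<in>UNIV. y $ j * k j y)"
      using form_Suc_decompose by blast
    then have "\<And>j. \<exists>c. k j = (\<lambda>_. c)" by (simp add: form_0_iff)
    then obtain c where "\<And>j. k j = (\<lambda>_. c j)" by metis
    then show ?thesis using k(2) by auto
  qed
  then obtain b where "\<And>i y. h i y = (\<Sum>j\<in>UNIV. y $ j * b i j)" by metis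
  then have "g y = (\<Sum>i\<in>UNIV. \<Sum>j\<in>UNIV. b i j * (y $ i * y $ j))" for y
    unfolding h(2) by (simp add: sum_distrib_left mult_ac)
  then show thesis by (rule that)
qed

text \<open>
  The signs make the matrix with rows \<open>(y\<^sub>6, y\<^sub>2, - y\<^sub>5)\<close> and \<open>(y\<^sub>2, - y\<^sub>5, - y\<^sub>4)\<close> equal to
  \<open>(s\<^sup>3, s\<^sup>2 t, s t\<^sup>2)\<close> and \<open>(s\<^sup>2 t, s t\<^sup>2, t\<^sup>3)\<close>.
\<close>
definition cubic :: "complex \<Rightarrow> complex \<Rightarrow> complex ^ 6" where
  "cubic s t = tuple6 0 (s^2 * t) 0 (- (t^3)) (- (s * t^2)) (s^3)"

lemma quadric_cubic: "n < 14 \<Longrightarrow> quadric n (cubic s t) = 0"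
proof -
  have "\<forall>n<14. quadric n (cubic s t) = 0"
    unfolding all_less_14 quadric_nth cubic_def tuple6_nth
    by (simp add: power2_eq_square power3_eq_cube)
  then show "n < 14 \<Longrightarrow> quadric n (cubic s t) = 0" by blast
qed

lemma form_quadric: "n < 14 \<Longrightarrow> form 2 (quadric n)"
proof -
  have "form (1 + 1) (\<lambda>y. y $ i * y $ j)" for i j :: 6
    by (intro form_mult form_coord)
  then have m: "form 2 (\<lambda>y. y $ i * y $ j)" for i j :: 6 by (simp only: one_add_one)
  have "\<forall>n<14. form 2 (\<lambda>y. quadric n y)"
    unfolding all_less_14 quadric_nth by (intro conjI form_add form_diff m)
  then show "n < 14 \<Longrightarrow> form 2 (quadric n)" by blast
qed

text \<open>
  Restricting to the affine curve \<open>t = 1\<close> gives a polynomial of degree six in \<open>s\<close>. Its seven coefficients are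
  the conditions on the ten monomials in \<open>y\<^sub>2, y\<^sub>4, y\<^sub>5, y\<^sub>6\<close>, and what they leave is spanned by the three
  minors.
\<close>
lemma quadrics_through_cubic:
  assumes g: "form 2 g" and zero: "\<And>s. g (cubic s 1) = 0"
  obtains c where "\<And>n. 14 \<le> n \<Longrightarrow> c n = 0" "\<And>y. g y = (\<Sum>n<14. c n * quadric n y)"
proof -
  obtain b where b: "\<And>y. g y = (\<Sum>i\<in>UNIV. \<Sum>j\<in>UNIV. b i j * (y $ i * y $ j))"
    using form_2E[OF g] by blast
  define d where "d i j = b i j + b j i" for i j
  \<comment> \<open>The coefficients of \<open>s\<^sup>0, \<dots>, s\<^sup>6\<close> of \<open>g\<close> on the curve.\<close>
  have "poly [: b 4 4, d 4 5, b 5 5 - d 2 4, - d 2 5 - d 4 6, b 2 2 - d 5 6, d 2 6, b 6 6 :] s = 0" for s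
    using zero[of s] unfolding b sum_UNIV_6 cubic_def tuple6_nth d_def
    by (simp add: algebra_simps power2_eq_square power3_eq_cube)
  then have "[: b 4 4, d 4 5, b 5 5 - d 2 4, - d 2 5 - d 4 6, b 2 2 - d 5 6, d 2 6, b 6 6 :] = 0"
    using poly_all_0_iff_0 by blast
  then have 0: "b 4 4 = 0" "d 4 5 = 0" "b 5 5 = d 2 4" "- d 2 5 = d 4 6" "b 2 2 = d 5 6" "d 2 6 = 0" "b 6 6 = 0"
    by simp_all
  define c where "c n = (if n < 14 then [b 1 1, d 1 2, d 1 3, d 1 4, d 1 5, d 1 6, d 2 3, b 3 3, d 3 4, d 3 5,
      d 3 6, d 4 6, d 5 6, d 2 4] ! n else 0)" for n :: nat
  have c: "c 0 = b 1 1" "c 1 = d 1 2" "c 2 = d 1 3" "c 3 = d 1 4" "c 4 = d 1 5" "c 5 = d 1 6" "c 6 = d 2 3"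
    "c 7 = b 3 3" "c 8 = d 3 4" "c 9 = d 3 5" "c 10 = d 3 6" "c 11 = d 4 6" "c 12 = d 5 6" "c 13 = d 2 4"
    by (simp_all add: c_def)
  have "g y = (\<Sum>n<14. c n * quadric n y)" for y
    using 0 unfolding b sum_UNIV_6 sum_14 quadric_nth c d_def by algebra
  then show thesis by (intro that[of c]) (simp_all add: c_def)
qed

text \<open>
  A relation between the quadrics is a linear functional on \<open>G2_span\<close> that vanishes on the image of
  \<open>\<phi>\<^sub>0\<close>, and this image spans.
\<close>
lemma quadrics_independent:
  assumes "\<And>y. (\<Sum>n<14. c n * quadric n y) = (\<Sum>n<14. c' n * quadric n y)" "m < 14"
  shows "c m = c' m"
proof -
  define S where "S = {x. (\<Sum>n<14. c n * G2_coord n x) = (\<Sum>n<14. c' n * G2_coord n x)}"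
  have "vec.subspace S"
    unfolding S_def
    by (rule vec.subspaceI) (simp_all add: G2_coord_lin distrib_left sum.distrib mult.left_commute[of _ "_ :: complex"] flip: sum_distrib_left)
  moreover have "\<phi>\<^sub>0 y \<in> S" for y
    using assms(1)[of y] by (simp add: S_def G2_coord_\<phi>\<^sub>0)
  ultimately have "G2_basis m \<in> S"
    using G2_basis_in_subspace assms(2) by blast
  then show ?thesis
    using assms(2) by (simp add: S_def G2_coord_basis if_distrib[of "(*) _"] cong: if_cong)
qed

section \<open>The projection and its inverse\<close>

lemma projective_variety_hatG2: "projective_variety hatG2"
  unfolding hatG2_eq
proof (rule projective_variety_parametrized)
  show "G2_basis 0 \<in> G2_cone" using \<phi>\<^sub>0_in_G2_cone by (metis \<phi>\<^sub>0_values(1))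
  show "G2_basis 0 \<noteq> 0" using G2_coord_basis[of 0 0] G2_coord_lin(3)[of 0] by auto
  show "form 2 (\<lambda>y. \<phi>\<^sub>0 y $ S)" for S by (rule form_\<phi>\<^sub>0)
  show "range \<phi>\<^sub>0 \<subseteq> G2_cone" using \<phi>\<^sub>0_in_G2_cone by blast
  show "G2_cone \<subseteq> closure {k *s \<phi>\<^sub>0 y | k y. True}"
    using G2_cone_subset_closure unfolding \<phi>\<^sub>0_multiples_def .
qed (rule zariski_closed_hatG2)

text \<open>
  A linear section of \<open>\<pi>\<^sub>0\<close> on \<open>G2_span\<close>.
\<close>
definition \<sigma>\<^sub>0 :: "complex ^ 6 \<Rightarrow> 7 ext" where
  "\<sigma>\<^sub>0 y = y $ 1 *s G2_basis 0 + y $ 2 *s G2_basis 1 + y $ 3 *s G2_basis 2 + y $ 4 *s G2_basis 3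
     + y $ 5 *s G2_basis 4 + y $ 6 *s G2_basis 5"

lemma \<sigma>\<^sub>0_in: "\<sigma>\<^sub>0 y \<in> G2_span"
  unfolding \<sigma>\<^sub>0_def by (intro vec.subspace_add vec.subspace_scale subspace_G2_span G2_basis_span) simp_all

lemma \<sigma>\<^sub>0_coord: "\<forall>n<6. G2_coord n (\<sigma>\<^sub>0 (\<pi>\<^sub>0 x)) = G2_coord n x"
proof -
  have a: "\<pi>\<^sub>0 x $ 1 = G2_coord 0 x" "\<pi>\<^sub>0 x $ 2 = G2_coord 1 x" "\<pi>\<^sub>0 x $ 3 = G2_coord 2 x"
    "\<pi>\<^sub>0 x $ 4 = G2_coord 3 x" "\<pi>\<^sub>0 x $ 5 = G2_coord 4 x" "\<pi>\<^sub>0 x $ 6 = G2_coord 5 x"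
    by (simp_all only: \<pi>\<^sub>0_def tuple6_nth G2_coord_nth)
  show ?thesis unfolding all_less_6 \<sigma>\<^sub>0_def a
    by (simp add: G2_coord_lin G2_coord_basis)
qed

lemma \<pi>\<^sub>0_\<phi>\<^sub>0: "\<pi>\<^sub>0 (\<phi>\<^sub>0 y) = y $ 1 *s y"
proof -
  have "\<forall>i. \<pi>\<^sub>0 (\<phi>\<^sub>0 y) $ i = (y $ 1 *s y) $ i"
    unfolding all_6 \<pi>\<^sub>0_def tuple6_nth \<phi>\<^sub>0_def pluecker_wedge tuple7_nth by simp
  then show ?thesis by (simp add: vec_eq_iff)
qed

text \<open>
  \<open>x\<close> and \<open>\<sigma>\<^sub>0 (\<pi>\<^sub>0 x)\<close> differ by an element of the span of \<open>F4\<close>, the kernel of \<open>p\<close>; so \<open>A = p \<circ> \<sigma>\<^sub>0\<close>. It is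
  surjective because \<open>p\<close> is, hence an automorphism.
\<close>
lemma projection_factors:
  assumes "linear_projection (lin_span hatG2) (lin_span F4) p"
  obtains A B :: "complex ^ 6 \<Rightarrow> complex ^ 6" where
    "Vector_Spaces.linear (*s) (*s) A" "Vector_Spaces.linear (*s) (*s) B"
    "\<And>y. B (A y) = y" "\<And>y. A (B y) = y" "\<And>x. x \<in> G2_span \<Longrightarrow> p x = A (\<pi>\<^sub>0 x)"
proof -
  have p: "Vector_Spaces.linear (*s) (*s) p" "p ` G2_span = UNIV" "{x \<in> G2_span. p x = 0} = F_span"
    using assms unfolding linear_projection_def lin_span_hatG2 lin_span_F4 by blast+
  interpret p: Vector_Spaces.linear "(*s)" "(*s)" p by (rule p(1))
  define A where "A y = p (\<sigma>\<^sub>0 y)" for y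
  have A: "Vector_Spaces.linear (*s) (*s) A"
    unfolding A_def \<sigma>\<^sub>0_def
    by unfold_locales (simp_all add: p.add p.scale algebra_simps vec.scale_right_distrib vec.scale_left_distrib)
  have pA: "p x = A (\<pi>\<^sub>0 x)" if "x \<in> G2_span" for x
  proof -
    have "x - \<sigma>\<^sub>0 (\<pi>\<^sub>0 x) \<in> F_span"
      unfolding F_span_def using that \<sigma>\<^sub>0_in \<sigma>\<^sub>0_coord[of x]
      by (auto simp: G2_coord_lin intro: vec.subspace_diff[OF subspace_G2_span])
    then have "p (x - \<sigma>\<^sub>0 (\<pi>\<^sub>0 x)) = 0" using p(3) by blast
    then show ?thesis by (simp add: A_def p.diff)
  qed
  have "\<exists>y. z = A y" for z
  proof -
    obtain x where "x \<in> G2_span" "p x = z" using p(2) by (metis UNIV_I imageE)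
    then show ?thesis using pA by blast
  qed
  then have "surj A" unfolding surj_def by blast
  then obtain B where "Vector_Spaces.linear (*s) (*s) B" "\<forall>y. B (A y) = y" "\<forall>y. A (B y) = y"
    using vec.linear_surjective_isomorphism[OF A] by blast
  then show thesis using that A pA by blast
qed

definition cubic_basis :: "nat \<Rightarrow> complex ^ 6" where
  "cubic_basis n = [tuple6 0 0 0 0 0 1, tuple6 0 1 0 0 0 0, tuple6 0 0 0 0 (- 1) 0, tuple6 0 0 0 (- 1) 0 0] ! n"

lemma sum_atMost_3: "(\<Sum>n\<le>3. f n) = f 0 + f 1 + f 2 + f (3::nat)"
  for f :: "nat \<Rightarrow> 'a::comm_monoid_add"
  by (simp add: atMost_nat_numeral atMost_Suc ac_simps)

lemma cubic_expand: "cubic s t = (\<Sum>n\<le>3. (s ^ (3 - n) * t ^ n) *s cubic_basis n)"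
proof -
  have "\<forall>i. cubic s t $ i = (\<Sum>n\<le>3. (s ^ (3 - n) * t ^ n) *s cubic_basis n) $ i"
    unfolding all_6 sum_atMost_3 cubic_def cubic_basis_def by (simp add: tuple6_nth)
  then show ?thesis by (simp add: vec_eq_iff)
qed

lemma linear_sum_scale:
  assumes "Vector_Spaces.linear (*s) (*s) A"
  shows "A (\<Sum>i\<in>I. c i *s x i) = (\<Sum>i\<in>I. c i *s A (x i))"
proof -
  interpret Vector_Spaces.linear "(*s)" "(*s)" A by (rule assms)
  show ?thesis by (simp add: sum scale)
qed

definition cubic_curve :: "(complex ^ 6 \<Rightarrow> complex ^ 6) \<Rightarrow> (complex ^ 6) set set" where
  "cubic_curve A = {vec.span {A (cubic s t)} | s t. (s, t) \<noteq> (0, 0)}"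

lemma twisted_cubic_curve:
  assumes A: "Vector_Spaces.linear (*s) (*s) A" and B: "Vector_Spaces.linear (*s) (*s) B"
    and BA: "\<And>y. B (A y) = y"
  shows "twisted_cubic (cubic_curve A)"
proof -
  define w where "w n = A (cubic_basis n)" for n
  define t where "t n v = [B v $ 6, B v $ 2, - B v $ 5, - B v $ 4] ! n" for n v
  interpret B: Vector_Spaces.linear "(*s)" "(*s)" B by (rule B)
  have le3: "n \<le> 3 \<longleftrightarrow> n = 0 \<or> n = 1 \<or> n = 2 \<or> n = 3" for n :: nat by auto
  have dual: "t i (w j) = (if i = j then 1 else 0)" if "i \<in> {..3}" "j \<in> {..3}" for i j
    using that unfolding atMost_iff le3
    by (elim disjE) (simp_all add: t_def w_def BA cubic_basis_def tuple6_nth)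
  have lin: "t i (\<Sum>j\<in>{..3}. c j *s w j) = (\<Sum>j\<in>{..3}. c j * t i (w j))" if "i \<in> {..3}" for i c
    using that unfolding atMost_iff le3
    by (elim disjE) (simp_all add: t_def linear_sum_scale[OF B] sum_negf)
  have "cubic_curve A = {vec.span {\<Sum>i\<le>3. (s ^ (3 - i) * t ^ i) *s w i} | s t. (s, t) \<noteq> (0, 0)}"
    unfolding cubic_curve_def cubic_expand linear_sum_scale[OF A] w_def ..
  then show ?thesis
    unfolding rational_normal_curve_def
    using independent_if_dual[of "{..3}" t w, OF _ dual lin] by blast
qed

lemma defined_by_quadrics:
  assumes A: "Vector_Spaces.linear (*s) (*s) A" and B: "Vector_Spaces.linear (*s) (*s) B"
    and BA: "\<And>y. B (A y) = y" and AB: "\<And>y. A (B y) = y"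
  shows "defined_by_system (forms_through 2 (cubic_curve A)) (lin_span hatG2) (\<lambda>y. \<phi>\<^sub>0 (B y))"
  unfolding defined_by_system_def
proof (intro exI[of _ 14] exI[of _ "\<lambda>n y. quadric n (B y)"] exI[of _ G2_basis] conjI allI impI ballI)
  interpret B: Vector_Spaces.linear "(*s)" "(*s)" B by (rule B)
  show "inj_on G2_basis {..<14}" "vec.independent (G2_basis ` {..<14})"
    by (rule G2_basis_independent; simp)+
  show "vec.span (G2_basis ` {..<14}) = lin_span hatG2"
    unfolding lin_span_hatG2 by (rule G2_basis_spans)
  show "\<phi>\<^sub>0 (B y) = (\<Sum>i<14. quadric i (B y) *s G2_basis i)" for y
    by (rule \<phi>\<^sub>0_expand)
  show "(\<lambda>y. quadric n (B y)) \<in> forms_through 2 (cubic_curve A)" if n: "n < 14" for n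
  proof -
    have "form (2 * 1) (\<lambda>y. quadric n (B y))"
      using form_quadric[OF n] form_linear[OF B] by (rule form_compose)
    moreover have "quadric n (B v) = 0" if P: "P \<in> cubic_curve A" "v \<in> P" for P v
    proof -
      obtain s t where "P = vec.span {A (cubic s t)}" using P(1) unfolding cubic_curve_def by blast
      then obtain k where "v = k *s A (cubic s t)" using P(2) by (auto simp: vec.span_singleton)
      then have "B v = k *s cubic s t" by (simp add: B.scale BA)
      then show ?thesis using form_scale[OF form_quadric[OF n]] quadric_cubic[OF n] by simp
    qed
    ultimately show ?thesis unfolding forms_through_def by simp
  qed
  fix f assume f: "f \<in> forms_through 2 (cubic_curve A)"
  have "form (2 * 1) (\<lambda>y. f (A y))"
    using f unfolding forms_through_def by (intro form_compose form_linear A) simp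
  then have "form 2 (\<lambda>y. f (A y))" by simp
  moreover have "f (A (cubic s 1)) = 0" for s
  proof -
    have "vec.span {A (cubic s 1)} \<in> cubic_curve A" unfolding cubic_curve_def by force
    moreover have "A (cubic s 1) \<in> vec.span {A (cubic s 1)}" by (simp add: vec.span_base)
    ultimately show ?thesis using f unfolding forms_through_def by blast
  qed
  ultimately obtain c where c: "\<And>n. 14 \<le> n \<Longrightarrow> c n = 0" "\<And>y. f (A y) = (\<Sum>n<14. c n * quadric n y)"
    using quadrics_through_cubic[of "\<lambda>y. f (A y)"] by metis
  show "\<exists>!c. (\<forall>i\<ge>14. c i = 0) \<and> f = (\<lambda>y. \<Sum>i<14. c i * quadric i (B y))"
  proof (rule ex1I[of _ c])
    show "(\<forall>i\<ge>14. c i = 0) \<and> f = (\<lambda>y. \<Sum>i<14. c i * quadric i (B y))"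
      using c(1) c(2)[of "B _"] by (auto simp: AB)
    fix c' assume c': "(\<forall>i\<ge>14. c' i = 0) \<and> f = (\<lambda>y. \<Sum>i<14. c' i * quadric i (B y))"
    have "(\<Sum>n<14. c' n * quadric n y) = (\<Sum>n<14. c n * quadric n y)" for y
    proof -
      have "f (A y) = (\<Sum>i<14. c' i * quadric i (B (A y)))" using c' by metis
      then show ?thesis using c(2)[of y] by (simp add: BA)
    qed
    then have "c' n = c n" if "n < 14" for n using quadrics_independent that by blast
    then show "c' = c" using c' c(1) by (metis ext not_less)
  qed
qed

text \<open>
  Both composites are multiplication by a linear form, \<open>p\<^sub>1\<^sub>5\<close> on the cone and the first coordinate of \<open>B y\<close> on
  the target. All the density conditions therefore follow from the density of the locus where that form does
  not vanish.
\<close>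
lemma birational_projection:
  assumes p: "Vector_Spaces.linear (*s) (*s) p"
    and A: "Vector_Spaces.linear (*s) (*s) A" and B: "Vector_Spaces.linear (*s) (*s) B"
    and BA: "\<And>y. B (A y) = y" and AB: "\<And>y. A (B y) = y"
    and pA: "\<And>x. x \<in> G2_span \<Longrightarrow> p x = A (\<pi>\<^sub>0 x)"
  shows "birational_with_inverse hatG2 PP p (\<lambda>y. \<phi>\<^sub>0 (B y))"
proof -
  interpret A: Vector_Spaces.linear "(*s)" "(*s)" A by (rule A)
  interpret B: Vector_Spaces.linear "(*s)" "(*s)" B by (rule B)
  let ?f = "\<lambda>y. \<phi>\<^sub>0 (B y)"
  let ?h = "\<lambda>x. pluecker x 1 5" and ?k = "\<lambda>y. B y $ 1"
  have form_p: "form 1 (\<lambda>v. p v $ i)" for i using p by (rule form_linear)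
  have "form (2 * 1) (\<lambda>y. ?f y $ S)" for S
    by (intro form_compose[OF form_\<phi>\<^sub>0] form_linear B)
  then have form_f: "form 2 (\<lambda>y. ?f y $ S)" for S by simp
  have p_f: "p (?f y) = ?k y *s y" for y
  proof -
    have "\<phi>\<^sub>0 (B y) \<in> G2_span" using \<phi>\<^sub>0_in_G2_cone G2_cone_iff by blast
    then show ?thesis by (simp add: pA \<pi>\<^sub>0_\<phi>\<^sub>0 A.scale AB)
  qed
  have f_p: "?f (p x) = ?h x *s x" if "x \<in> G2_cone" for x
    using that G2_cone_iff by (simp add: pA BA \<phi>\<^sub>0_\<pi>\<^sub>0)
  have h: "p x \<noteq> 0" if "?h x \<noteq> 0" "x \<in> G2_cone" for x
  proof
    assume "p x = 0"
    then have "?f 0 = ?h x *s x" using f_p[OF that(2)] by simp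
    moreover have "?f 0 = 0" unfolding B.zero \<phi>\<^sub>0_expand sum_14 quadric_nth by simp
    ultimately have "x = 0" using that(1) by simp
    then show False using that(1) by (simp add: pluecker_lin)
  qed
  have k: "?f y \<noteq> 0" if "?k y \<noteq> 0" for y
  proof
    interpret p: Vector_Spaces.linear "(*s)" "(*s)" p by (rule p)
    assume "?f y = 0"
    then have "?k y *s y = 0" using p_f[of y] p.zero by simp
    then have "y = 0" using that by simp
    then show False using that B.zero by simp
  qed
  have X: "projective_variety hatG2" by (rule projective_variety_hatG2)
  have dense_X: "zariski_dense U hatG2"
    if "U \<subseteq> hatG2" "\<And>x. x \<in> G2_cone \<Longrightarrow> ?h x \<noteq> 0 \<Longrightarrow> vec.span {x} \<in> U" for U
  proof (rule zariski_dense_nonzero_locus[OF X form_pluecker[of 1 5] _ _ _ that(1)])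
    have 1: "?h (G2_basis 0) = 1" by (simp add: G2_basis_nth pluecker_basis_wedge)
    then have "G2_basis 0 \<noteq> 0" by (auto simp: pluecker_lin)
    moreover have "G2_basis 0 \<in> G2_cone" using \<phi>\<^sub>0_in_G2_cone by (metis \<phi>\<^sub>0_values(1))
    ultimately show "vec.span {G2_basis 0} \<in> hatG2" unfolding hatG2_eq proj_space_def by blast
    show "G2_basis 0 \<in> vec.span {G2_basis 0}" by (simp add: vec.span_base)
    show "?h (G2_basis 0) \<noteq> 0" using 1 by simp
    fix P assume P: "P \<in> hatG2" "\<exists>v\<in>P. ?h v \<noteq> 0"
    obtain x where x: "x \<in> G2_cone" "P = vec.span {x}" using P(1) unfolding hatG2_eq by (rule proj_spaceE)
    then have "?h x \<noteq> 0" using P(2) form_zero_on_line[OF form_pluecker[of 1 5]] by blast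
    then show "P \<in> U" using that(2) x by blast
  qed
  have form_k: "form 1 ?k" using B by (rule form_linear)
  have dense_Y: "zariski_dense U PP"
    if "U \<subseteq> PP" "\<And>y. ?k y \<noteq> 0 \<Longrightarrow> vec.span {y} \<in> U" for U
  proof (rule zariski_dense_nonzero_locus[OF projective_variety_PP form_k _ _ _ that(1)])
    let ?y = "A (tuple6 1 0 0 0 0 0)"
    have 1: "?k ?y = 1" by (simp add: BA tuple6_nth)
    then have "?y \<noteq> 0" using B.zero by auto
    then show "vec.span {?y} \<in> PP" by (rule span_in_PP)
    show "?y \<in> vec.span {?y}" by (simp add: vec.span_base)
    show "?k ?y \<noteq> 0" using 1 by simp
    fix P assume P: "P \<in> PP" "\<exists>v\<in>P. ?k v \<noteq> 0"
    obtain y where y: "P = vec.span {y}" using P(1) by (rule proj_spaceE)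
    then have "?k y \<noteq> 0" using P(2) form_zero_on_line[OF form_k] by blast
    then show "P \<in> U" using that(2) y by blast
  qed
  have in_X: "vec.span {x} \<in> hatG2" if "x \<in> G2_cone" "x \<noteq> 0" for x
    using that unfolding hatG2_eq proj_space_def by blast
  have XE: thesis if "P \<in> hatG2" "\<And>x. x \<in> G2_cone \<Longrightarrow> x \<noteq> 0 \<Longrightarrow> P = vec.span {x} \<Longrightarrow> thesis" for P thesis
    using that unfolding hatG2_eq by (blast elim: proj_spaceE)
  have h0: "x \<noteq> 0" if "?h x \<noteq> 0" for x using that by (auto simp: pluecker_lin)
  have k0: "y \<noteq> 0" if "?k y \<noteq> 0" for y using that B.zero by auto
  have "rational_map hatG2 PP p"
    unfolding rational_map_def
  proof (intro conjI X projective_variety_PP)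
    show "\<exists>d. \<forall>i. form d (\<lambda>v. p v $ i)" using form_p by blast
    show "zariski_dense {P \<in> hatG2. defined_at p P} hatG2"
      using h h0 in_X by (intro dense_X) (auto simp: defined_at_span[OF form_p])
    show "proj_map p ` {P \<in> hatG2. defined_at p P} \<subseteq> PP"
      by (auto elim!: XE simp: defined_at_span[OF form_p] proj_map_span[OF form_p] span_in_PP)
  qed
  moreover have "rational_map PP hatG2 ?f"
    unfolding rational_map_def
  proof (intro conjI X projective_variety_PP)
    show "\<exists>d. \<forall>i. form d (\<lambda>v. ?f v $ i)" using form_f by blast
    show "zariski_dense {P \<in> PP. defined_at ?f P} PP"
      using k k0 by (intro dense_Y) (auto simp: defined_at_span[OF form_f] span_in_PP)
    show "proj_map ?f ` {P \<in> PP. defined_at ?f P} \<subseteq> hatG2"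
      by (auto elim!: proj_spaceE simp: defined_at_span[OF form_f] proj_map_span[OF form_f] in_X \<phi>\<^sub>0_in_G2_cone)
  qed
  moreover have "rational_left_inverse hatG2 p ?f"
    unfolding rational_left_inverse_def Let_def
  proof (intro conjI ballI)
    show "zariski_dense {P \<in> hatG2. defined_at p P \<and> defined_at ?f (proj_map p P)} hatG2"
      using h h0 in_X f_p
      by (intro dense_X) (auto simp: defined_at_span[OF form_p] proj_map_span[OF form_p] defined_at_span[OF form_f])
    fix P assume "P \<in> {P \<in> hatG2. defined_at p P \<and> defined_at ?f (proj_map p P)}"
    then show "proj_map ?f (proj_map p P) = P"
      using f_p by (auto elim!: XE simp: proj_map_span[OF form_p] proj_map_span[OF form_f] defined_at_span[OF form_f] span_singleton_scale)
  qed
  moreover have "rational_left_inverse PP ?f p"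
    unfolding rational_left_inverse_def Let_def
  proof (intro conjI ballI)
    show "zariski_dense {P \<in> PP. defined_at ?f P \<and> defined_at p (proj_map ?f P)} PP"
      using k k0 p_f
      by (intro dense_Y) (auto simp: defined_at_span[OF form_p] proj_map_span[OF form_f] defined_at_span[OF form_f] span_in_PP)
    fix P assume "P \<in> {P \<in> PP. defined_at ?f P \<and> defined_at p (proj_map ?f P)}"
    then show "proj_map p (proj_map ?f P) = P"
      using p_f by (auto elim!: proj_spaceE simp: proj_map_span[OF form_p] proj_map_span[OF form_f] defined_at_span[OF form_p] span_singleton_scale)
  qed
  ultimately show ?thesis unfolding birational_with_inverse_def by blast
qed

theorem proposition3p9:
  "vec.dim (lin_span hatG2) = 14 \<and>
   vec.dim (lin_span F4) = 8 \<and>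
   (\<forall>p :: 7 ext \<Rightarrow> complex ^ 6. linear_projection (lin_span hatG2) (lin_span F4) p \<longrightarrow>
      (\<exists>(C :: (complex ^ 6) set set) (\<phi> :: complex ^ 6 \<Rightarrow> 7 ext).
         twisted_cubic C \<and>
         defined_by_system (forms_through 2 C) (lin_span hatG2) \<phi> \<and>
         birational_with_inverse hatG2 PP p \<phi>))"
proof (intro conjI allI impI dim_lin_span_hatG2 dim_lin_span_F4)
  fix p :: "7 ext \<Rightarrow> complex ^ 6"
  assume p: "linear_projection (lin_span hatG2) (lin_span F4) p"
  obtain A B :: "complex ^ 6 \<Rightarrow> complex ^ 6" where AB:
    "Vector_Spaces.linear (*s) (*s) A" "Vector_Spaces.linear (*s) (*s) B"
    "\<And>y. B (A y) = y" "\<And>y. A (B y) = y" "\<And>x. x \<in> G2_span \<Longrightarrow> p x = A (\<pi>\<^sub>0 x)"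
    using projection_factors[OF p] by metis
  have "Vector_Spaces.linear (*s) (*s) p" using p unfolding linear_projection_def by blast
  then show "\<exists>C \<phi>. twisted_cubic C \<and> defined_by_system (forms_through 2 C) (lin_span hatG2) \<phi> \<and>
      birational_with_inverse hatG2 PP p \<phi>"
    using twisted_cubic_curve defined_by_quadrics birational_projection AB by blast
qed

end
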